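(* Let $\gamma>0$, generate a Poisson point process $\Xi_\gamma$ on $\mathbb X$ with intensity measure $\gamma e^{B_{\boldsymbol n}(y)}\mu_0$, write it as $\Xi_\gamma=\sum_i\delta_{Q_i}$, and retain an atom $Q_i$ if all $J$ component likelihood coins $G_{n_j,y_j}$, $j=1,\dots,J$, generated from the $p_j(Q_i)$-coin oracles succeed (and discard it otherwise). Then the retained process $\eta_\gamma$ is a Poisson point process with intensity measure $\gamma\nu^y$, where $\nu^y(\mathrm dq)=L(q;y)\,\mu_0(\mathrm dq)$. No numerical value of $p_j(q)$, $L(q;y)$, or $Z(y)=\int_{\mathbb X}L(q;y)\,\mu_0(\mathrm dq)$ is required by the sampler.
   Context: $(\mathbb X,\mathcal X)$ is a measurable space with prior probability measure $\mu_0$. The observation model is $y_j=p_j(q)+\varepsilon_j$, $j=1,\dots,J$, with $p_j(q),y_j\in[0,1]$ and independent errors $\varepsilon_j\sim\mathcal N(0,\sigma_j^2)$, $\sigma_j^2>0$. Put $a_j=1/(2\sigma_j^2)$; the reduced likelihood is $L(q;y)=\exp\{-\sum_{j=1}^Ja_j[p_j(q)-y_j]^2\}$, which is measurable in $q$. The sampler accesses each $p_j(q)$ only through an oracle (a $p_j(q)$-coin oracle) returning independent Bernoulli variables with success probability $p_j(q)$; repeated queries use independent auxiliary randomness. For an integer $n\ge2$, scalar $y\in[0,1]$ and $0\le k\le n$: $\beta_{k,n}(y)=y^2-\frac{2yk}{n}+\frac{k(k-1)}{n(n-1)}$, $b_n(y)=-\min_{0\le k\le n}\beta_{k,n}(y)\ge0$,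 $c_{k,n}(y)=\beta_{k,n}(y)+b_n(y)$, $C_n(y)=\max\{1,\max_{0\le k\le n}c_{k,n}(y)\}$. Orders $\boldsymbol n=(n_1,\dots,n_J)$ with $n_j\ge2$ are fixed and $B_{\boldsymbol n}(y)=\sum_{j=1}^Ja_jb_{n_j}(y_j)$. The component likelihood coin $G_{n_j,y_j}$ at $q$ is generated by drawing $R_j\sim\operatorname{Poisson}(a_jC_{n_j}(y_j))$ and, independently, $R_j$ independent auxiliary Bernoulli variables, each obtained by letting $K$ be the number of successes in $n_j$ independent $p_j(q)$-coins and then drawing a Bernoulli variable with success probability $c_{K,n_j}(y_j)/C_{n_j}(y_j)$; $G_{n_j,y_j}=1$ (success) iff all $R_j$ auxiliary variables are zero. The coins are generated independently across components and, given the atoms, across atoms. *)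

theory Defs
  imports "HOL-Probability.Probability"
begin

text \<open>
  The Bernstein coefficients of degree \<open>n\<close> of the polynomial \<open>x \<mapsto> (x - y)\<^sup>2\<close>; \<open>bern_b\<close> is the least
  shift that makes them nonnegative, and \<open>bern_C\<close> scales the shifted ones into the unit interval.
\<close>

definition bern_beta :: "nat \<Rightarrow> real \<Rightarrow> nat \<Rightarrow> real" where
  "bern_beta n y k = y^2 - 2 * y * real k / real n
     + real k * (real k - 1) / (real n * (real n - 1))"

definition bern_b :: "nat \<Rightarrow> real \<Rightarrow> real" where
  "bern_b n y = - Min (bern_beta n y ` {0..n})"

definition bern_c :: "nat \<Rightarrow> real \<Rightarrow> nat \<Rightarrow> real" where
  "bern_c n y k = bern_beta n y k + bern_b n y"

definition bern_C :: "nat \<Rightarrow> real \<Rightarrow> real" where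
  "bern_C n y = max 1 (Max (bern_c n y ` {0..n}))"

definition total_shift :: "nat \<Rightarrow> (nat \<Rightarrow> real) \<Rightarrow> (nat \<Rightarrow> nat) \<Rightarrow> (nat \<Rightarrow> real) \<Rightarrow> real" where
  "total_shift J a n y = (\<Sum>j=1..J. a j * bern_b (n j) (y j))"

definition reduced_likelihood ::
  "nat \<Rightarrow> (nat \<Rightarrow> real) \<Rightarrow> (nat \<Rightarrow> 'x \<Rightarrow> real) \<Rightarrow> (nat \<Rightarrow> real) \<Rightarrow> 'x \<Rightarrow> real" where
  "reduced_likelihood J a p y q = exp (- (\<Sum>j=1..J. a j * (p j q - y j)^2))"

text \<open>
  A program may draw Poisson and Bernoulli variables with parameters that it names itself
  (\<open>Poisson\<close>, \<open>Bernoulli\<close>), and it may toss the oracle coin (\<open>Coin\<close>). It receives the outcome of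
  a toss, never the success probability of the oracle; that number enters only in the
  interpretation \<open>run_prog\<close>. Successive draws and tosses are independent. The rate in \<open>Poisson\<close>
  has to be positive for \<^const>\<open>poisson_pmf\<close> to be the Poisson distribution.
\<close>

datatype 'r oracle_prog =
    Return 'r
  | Coin "bool \<Rightarrow> 'r oracle_prog"
  | Bernoulli real "bool \<Rightarrow> 'r oracle_prog"
  | Poisson real "nat \<Rightarrow> 'r oracle_prog"

primrec bind_prog :: "'r oracle_prog \<Rightarrow> ('r \<Rightarrow> 's oracle_prog) \<Rightarrow> 's oracle_prog" where
  "bind_prog (Return x) h = h x"
| "bind_prog (Coin f) h = Coin (\<lambda>b. bind_prog (f b) h)"
| "bind_prog (Bernoulli r f) h = Bernoulli r (\<lambda>b. bind_prog (f b) h)"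
| "bind_prog (Poisson l f) h = Poisson l (\<lambda>k. bind_prog (f k) h)"

primrec run_prog :: "real \<Rightarrow> 'r oracle_prog \<Rightarrow> 'r pmf" where
  "run_prog p (Return x) = return_pmf x"
| "run_prog p (Coin f) = bind_pmf (bernoulli_pmf p) (\<lambda>b. run_prog p (f b))"
| "run_prog p (Bernoulli r f) = bind_pmf (bernoulli_pmf r) (\<lambda>b. run_prog p (f b))"
| "run_prog p (Poisson l f) = bind_pmf (poisson_pmf l) (\<lambda>k. run_prog p (f k))"

primrec count_heads :: "nat \<Rightarrow> nat oracle_prog" where
  "count_heads 0 = Return 0"
| "count_heads (Suc n) =
     bind_prog (count_heads n) (\<lambda>k. Coin (\<lambda>b. Return (if b then Suc k else k)))"

definition auxiliary_bit :: "nat \<Rightarrow> real \<Rightarrow> bool oracle_prog" where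
  "auxiliary_bit n y =
     bind_prog (count_heads n) (\<lambda>k. Bernoulli (bern_c n y k / bern_C n y) Return)"

text \<open>\<open>none_of r e\<close> runs \<open>e\<close> independently \<open>r\<close> times and reports whether all outcomes were \<open>False\<close>.\<close>

primrec none_of :: "nat \<Rightarrow> bool oracle_prog \<Rightarrow> bool oracle_prog" where
  "none_of 0 e = Return True"
| "none_of (Suc r) e =
     bind_prog e (\<lambda>x. bind_prog (none_of r e) (\<lambda>z. Return (\<not> x \<and> z)))"

text \<open>
  The component likelihood coin. Its parameters are \<open>a\<close>, \<open>n\<close> and \<open>y\<close> alone: no value of the
  oracle probability, of the likelihood or of its normalising constant is available to it.
\<close>

definition likelihood_coin :: "real \<Rightarrow> nat \<Rightarrow> real \<Rightarrow> bool oracle_prog" where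
  "likelihood_coin a n y = Poisson (a * bern_C n y) (\<lambda>r. none_of r (auxiliary_bit n y))"

text \<open>
  \<open>sum_dirac M I x\<close> is the measure \<open>\<Sum>i\<in>I. \<delta>\<^bsub>x i\<^esub>\<close> on the measurable space of \<open>M\<close>, written as the
  image of the counting measure on \<open>I\<close>; only the sigma-algebra of \<open>M\<close> is used.
\<close>

definition sum_dirac :: "'x measure \<Rightarrow> nat set \<Rightarrow> (nat \<Rightarrow> 'x) \<Rightarrow> 'x measure" where
  "sum_dirac M I x = distr (count_space I) M x"

definition point_process :: "'w measure \<Rightarrow> 'x measure \<Rightarrow> ('w \<Rightarrow> 'x measure) \<Rightarrow> bool" where
  "point_process P M \<Xi> \<longleftrightarrow>
     (\<forall>\<omega>\<in>space P. sets (\<Xi> \<omega>) = sets M \<and>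
        (\<forall>A\<in>sets M. emeasure (\<Xi> \<omega>) A \<in> range ennreal_of_enat)) \<and>
     (\<forall>A\<in>sets M. (\<lambda>\<omega>. emeasure (\<Xi> \<omega>) A) \<in> borel_measurable P)"

text \<open>
  The Poisson weights are written out because \<^const>\<open>poisson_pmf\<close> excludes the rate \<open>0\<close>,
  which is needed for null sets of the intensity measure.
\<close>

definition poisson_point_process ::
  "'w measure \<Rightarrow> 'x measure \<Rightarrow> ('w \<Rightarrow> 'x measure) \<Rightarrow> bool" where
  "poisson_point_process P \<Lambda> \<Xi> \<longleftrightarrow>
     prob_space P \<and> point_process P \<Lambda> \<Xi> \<and>
     (\<forall>A\<in>sets \<Lambda>. emeasure \<Lambda> A < \<infinity> \<longrightarrow>
        (\<forall>k::nat. measure P {\<omega>\<in>space P. emeasure (\<Xi> \<omega>) A = of_nat k}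
                 = measure \<Lambda> A ^ k / fact k * exp (- measure \<Lambda> A))) \<and>
     (\<forall>A\<in>sets \<Lambda>. emeasure \<Lambda> A = \<infinity> \<longrightarrow> (AE \<omega> in P. emeasure (\<Xi> \<omega>) A = \<infinity>)) \<and>
     (\<forall>(m::nat) A. (\<forall>k<m. A k \<in> sets \<Lambda>) \<and> disjoint_family_on A {..<m} \<longrightarrow>
        prob_space.indep_vars P (\<lambda>_. borel) (\<lambda>k \<omega>. emeasure (\<Xi> \<omega>) (A k)) {..<m})"

text \<open>The sigma-algebra on the sample space generated by the number of atoms and their positions.\<close>

definition atom_algebra ::
  "'w measure \<Rightarrow> 'x measure \<Rightarrow> ('w \<Rightarrow> enat) \<Rightarrow> (nat \<Rightarrow> 'w \<Rightarrow> 'x) \<Rightarrow> 'w measure" where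
  "atom_algebra P M N Q =
     vimage_algebra (space P) (\<lambda>\<omega>. (N \<omega>, \<lambda>i. Q i \<omega>))
       (count_space UNIV \<Otimes>\<^sub>M PiM UNIV (\<lambda>_. M))"

text \<open>
  \<open>G i j\<close> is the component coin \<open>j\<close> generated at atom \<open>i\<close>. Conditionally on the atoms, all these
  coins are independent, and \<open>G i j\<close> is distributed as the output of the program
  \<open>likelihood_coin\<close> run with the coin oracle of success probability \<open>p j (Q i)\<close>. Nothing is said
  about indices \<open>i\<close> beyond the number \<open>N\<close> of atoms.
\<close>

definition component_coins ::
  "'w measure \<Rightarrow> 'x measure \<Rightarrow> ('w \<Rightarrow> enat) \<Rightarrow> (nat \<Rightarrow> 'w \<Rightarrow> 'x) \<Rightarrow>
   nat \<Rightarrow> (nat \<Rightarrow> real) \<Rightarrow> (nat \<Rightarrow> nat) \<Rightarrow> (nat \<Rightarrow> real) \<Rightarrow> (nat \<Rightarrow> 'x \<Rightarrow> real) \<Rightarrow>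
   (nat \<Rightarrow> nat \<Rightarrow> 'w \<Rightarrow> bool) \<Rightarrow> bool" where
  "component_coins P M N Q J a n y p G \<longleftrightarrow>
     (\<forall>i. \<forall>j\<in>{1..J}. G i j \<in> measurable P (count_space UNIV)) \<and>
     (\<forall>I g. finite I \<longrightarrow>
        (AE \<omega> in P. (\<forall>i\<in>I. enat i < N \<omega>) \<longrightarrow>
           real_cond_exp P (atom_algebra P M N Q)
             (\<lambda>\<omega>'. of_bool (\<forall>i\<in>I. \<forall>j\<in>{1..J}. G i j \<omega>' = g i j)) \<omega>
           = (\<Prod>i\<in>I. \<Prod>j=1..J.
                pmf (run_prog (p j (Q i \<omega>)) (likelihood_coin (a j) (n j) (y j))) (g i j))))"

end

theory Submission
  imports Defs
begin

text \<open>
  Two facts make the sampler work. First, each component coin succeeds with a probability that is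
  an explicit exponential. The numbers \<open>bern_c n y k\<close> are the Bernstein coefficients of
  \<open>x \<mapsto> (x - y)\<^sup>2 + bern_b n y\<close>, so averaging them over a binomial count of tosses of a
  \<open>q\<close>-coin gives exactly \<open>(q - y)\<^sup>2 + bern_b n y\<close>. An auxiliary bit is therefore one with
  probability \<open>((q - y)\<^sup>2 + bern_b n y) / bern_C n y\<close>, and a Poisson number of mean
  \<open>a * bern_C n y\<close> of such bits is entirely zero with probability
  \<open>exp (- a * ((q - y)\<^sup>2 + bern_b n y))\<close> (\<open>pmf_likelihood_coin\<close>). The factor \<open>bern_C n y\<close> cancels,
  and the product over the components is \<open>exp (- total_shift J a n y)\<close> times the reduced
  likelihood; the shift is what the intensity of the proposal process compensates.

  Second, thinning a Poisson process of finite intensity \<open>\<Lambda>\<close> with retention probability \<open>t\<close> gives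
  a Poisson process of intensity \<open>t \<Lambda>\<close> (\<open>retained_poisson\<close>). The argument runs through the
  generating functional. For disjoint regions \<open>A k\<close> and \<open>s k \<in> [0, 1]\<close>, put
  \<open>h = (\<Sum>k. (1 - s k) * indicator (A k))\<close>. Then \<open>\<Prod>k. s k ^ (number of retained atoms in A k)\<close> is the
  product over all atoms \<open>Q i\<close> of \<open>1 - R i * h (Q i)\<close>, where \<open>R i\<close> tells whether the atom is
  retained. This is affine in each \<open>R i\<close>, so conditioning on the atoms replaces \<open>R i\<close> by \<open>t (Q i)\<close>
  (\<open>integral_marked_prod\<close>). The expectation that results is the generating functional of the
  original process, hence equal to \<open>exp (- (\<integral>t * h \<partial>\<Lambda>))\<close> (\<open>poisson_functional\<close>), which is the product
  of the Poisson generating functions with means \<open>\<integral>t * indicator (A k) \<partial>\<Lambda>\<close>. A joint generating function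
  determines the joint law of the counts, and so the retained counts are independent Poisson
  variables (\<open>poisson_point_processI_pgf\<close>).
\<close>

section \<open>Poisson weights\<close>

text \<open>
  The rate \<open>l = 0\<close> has to be included, since regions that are null for the intensity occur;
  this is why the weights are written out instead of using \<^const>\<open>poisson_pmf\<close>.
\<close>

definition poisson_weight :: "real \<Rightarrow> nat \<Rightarrow> real" where
  "poisson_weight l k = l ^ k / fact k * exp (- l)"

lemma poisson_weight_pgf: "(\<lambda>k. poisson_weight l k * s ^ k) sums exp (- (1 - s) * l)"
proof -
  have "(\<lambda>r. (l ^ r / fact r * exp (- l)) * s ^ r) sums (exp (l * s) * exp (- l))"
    using sums_mult2[OF exp_converges[of "l * s"], of "exp (- l)"]
    by (simp add: field_simps power_mult_distrib scaleR_conv_of_real)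
  then show ?thesis by (simp add: poisson_weight_def exp_add[symmetric] algebra_simps)
qed

lemma poisson_weight_bounds:
  assumes "0 \<le> l" shows "0 \<le> poisson_weight l k" "poisson_weight l k \<le> 1"
proof -
  show nn: "0 \<le> poisson_weight l k" for k using assms by (simp add: poisson_weight_def)
  have s: "poisson_weight l sums 1" using poisson_weight_pgf[of l 1] by simp
  have "(\<Sum>i\<in>{k}. poisson_weight l i) \<le> (\<Sum>i. poisson_weight l i)"
    using s nn by (intro sum_le_suminf) (auto simp: sums_iff)
  then show "poisson_weight l k \<le> 1" using s by (simp add: sums_iff)
qed

section \<open>The success probability of a likelihood coin\<close>

lemma run_bind_prog:
  "run_prog q (bind_prog e h) = bind_pmf (run_prog q e) (\<lambda>x. run_prog q (h x))"
  by (induction e) (simp_all add: bind_return_pmf bind_assoc_pmf)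

lemma run_count_heads:
  assumes "q \<in> {0..1}"
  shows "run_prog q (count_heads n) = binomial_pmf n q"
proof (induction n)
  case 0
  then show ?case using assms by (simp add: binomial_pmf_0)
next
  case (Suc n)
  have "run_prog q (count_heads (Suc n)) =
      bind_pmf (binomial_pmf n q) (\<lambda>k. bind_pmf (bernoulli_pmf q)
        (\<lambda>b. return_pmf (if b then Suc k else k)))"
    using Suc by (simp add: run_bind_prog)
  also have "\<dots> = bind_pmf (bernoulli_pmf q) (\<lambda>b. bind_pmf (binomial_pmf n q)
        (\<lambda>k. return_pmf (if b then Suc k else k)))"
    by (rule bind_commute_pmf)
  also have "\<dots> = binomial_pmf (Suc n) q"
    using assms by (simp add: binomial_pmf_Suc, intro bind_pmf_cong refl, auto)
  finally show ?case .
qed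

lemma bern_c_nonneg: "k \<le> n \<Longrightarrow> 0 \<le> bern_c n y k"
  unfolding bern_c_def bern_b_def using Min_le[of "bern_beta n y ` {0..n}" "bern_beta n y k"]
  by (auto simp del: minus_Min_eq_Max)

lemma bern_c_le_C: "k \<le> n \<Longrightarrow> bern_c n y k \<le> bern_C n y"
  unfolding bern_C_def by (auto intro!: Max_ge max.coboundedI2)

lemma bern_C_pos: "0 < bern_C n y"
  unfolding bern_C_def by linarith

text \<open>
  The monomials \<open>1\<close>, \<open>x\<close> and \<open>x\<^sup>2\<close> have degree-\<open>n\<close> Bernstein coefficients \<open>1\<close>, \<open>k / n\<close> and
  \<open>k * (k - 1) / (n * (n - 1))\<close>; the last one is where \<open>2 \<le> n\<close> enters.
\<close>

lemma sum_bern_c_Bernstein: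
  assumes "2 \<le> n"
  shows "(\<Sum>k\<le>n. Bernstein n k q * bern_c n y k) = (q - y)^2 + bern_b n y"
proof -
  have n: "real n \<noteq> 0" "real n - 1 \<noteq> 0" using assms by auto
  have "(\<Sum>k\<le>n. Bernstein n k q * bern_c n y k) =
     (y^2 + bern_b n y) * (\<Sum>k\<le>n. Bernstein n k q)
     - 2 * y / real n * (\<Sum>k\<le>n. real k * Bernstein n k q)
     + (\<Sum>k\<le>n. real k * (real k - 1) * Bernstein n k q) / (real n * (real n - 1))"
    unfolding sum_distrib_left sum_divide_distrib sum.distrib[symmetric] sum_subtractf[symmetric]
    by (intro sum.cong) (auto simp: bern_c_def bern_beta_def algebra_simps)
  also have "\<dots> = (q - y)^2 + bern_b n y"
    using n unfolding sum_Bernstein sum_k_Bernstein sum_kk_Bernstein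
    by (simp add: power2_diff)
  finally show ?thesis .
qed

lemma pmf_auxiliary_bit:
  assumes "q \<in> {0..1}" "2 \<le> n"
  shows "pmf (run_prog q (auxiliary_bit n y)) True = ((q - y)^2 + bern_b n y) / bern_C n y"
proof -
  have "pmf (run_prog q (auxiliary_bit n y)) True =
      measure_pmf.expectation (binomial_pmf n q)
        (\<lambda>k. pmf (bernoulli_pmf (bern_c n y k / bern_C n y)) True)"
    using assms by (simp add: auxiliary_bit_def run_bind_prog run_count_heads pmf_bind bind_return_pmf')
  also have "\<dots> = (\<Sum>k\<le>n. Bernstein n k q * pmf (bernoulli_pmf (bern_c n y k / bern_C n y)) True)"
    using assms by (simp add: expectation_binomial_pmf' Bernstein_def)
  also have "\<dots> = (\<Sum>k\<le>n. Bernstein n k q * bern_c n y k) / bern_C n y"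
    unfolding sum_divide_distrib
    by (intro sum.cong refl, subst pmf_bernoulli_True)
      (use bern_C_pos[of n y] in \<open>auto simp: bern_c_nonneg bern_c_le_C divide_le_eq_1\<close>)
  finally show ?thesis using sum_bern_c_Bernstein[OF assms(2)] by simp
qed

lemma pmf_none_of:
  "pmf (run_prog q (none_of r e)) True = (1 - pmf (run_prog q e) True) ^ r"
proof (induction r)
  case 0
  then show ?case by simp
next
  case (Suc r)
  have "pmf (run_prog q (none_of (Suc r) e)) True =
     measure_pmf.expectation (run_prog q e)
       (\<lambda>x. measure_pmf.expectation (run_prog q (none_of r e)) (\<lambda>z. of_bool (\<not> x \<and> z)))"
    by (simp add: run_bind_prog pmf_bind indicator_def of_bool_def)
  also have "\<dots> = pmf (run_prog q e) False * pmf (run_prog q (none_of r e)) True"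
    by (simp add: integral_measure_pmf[of UNIV] UNIV_bool)
  finally show ?case using Suc by (simp add: pmf_False_conv_True)
qed

lemma expectation_poisson_power:
  fixes z :: real
  assumes "0 < l" "0 \<le> z"
  shows "measure_pmf.expectation (poisson_pmf l) (\<lambda>r. z ^ r) = exp (- (1 - z) * l)"
proof -
  note s = poisson_weight_pgf[of l z]
  have "integrable (count_space UNIV) (\<lambda>r. poisson_weight l r * z ^ r)"
    using s assms by (simp add: integrable_count_space_nat_iff sums_iff abs_mult poisson_weight_def)
  moreover have "measure_pmf.expectation (poisson_pmf l) (\<lambda>r. z ^ r) =
      integral\<^sup>L (count_space UNIV) (\<lambda>r. poisson_weight l r * z ^ r)"
    unfolding measure_pmf_eq_density using assms
    by (subst integral_density) (auto simp: poisson_weight_def)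
  ultimately show ?thesis
    using s by (simp add: integral_count_space_nat sums_iff)
qed

text \<open>
  This is Poisson thinning on a small scale: the number of ones among a Poisson number of
  auxiliary bits is again Poisson, and the coin succeeds when that number is zero.
\<close>

lemma pmf_likelihood_coin:
  assumes "q \<in> {0..1}" "2 \<le> n" "0 < a"
  shows "pmf (run_prog q (likelihood_coin a n y)) True = exp (- a * ((q - y)^2 + bern_b n y))"
proof -
  let ?t = "pmf (run_prog q (auxiliary_bit n y)) True"
  have "pmf (run_prog q (likelihood_coin a n y)) True =
      measure_pmf.expectation (poisson_pmf (a * bern_C n y)) (\<lambda>r. (1 - ?t) ^ r)"
    by (simp add: likelihood_coin_def pmf_bind pmf_none_of)
  also have "\<dots> = exp (- ?t * (a * bern_C n y))"
    using assms bern_C_pos[of n y] by (subst expectation_poisson_power) (auto simp: pmf_le_1)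
  also have "\<dots> = exp (- a * ((q - y)^2 + bern_b n y))"
    using bern_C_pos[of n y] assms by (simp add: pmf_auxiliary_bit)
  finally show ?thesis .
qed

section \<open>Poisson laws recovered from generating functions\<close>

text \<open>
  Only nonnegative arguments are available for probability generating functions, so agreement is
  assumed on the right of \<open>0\<close> alone. If the coefficients below \<open>n\<close> agree, then \<open>a n - b n\<close> is the
  one-sided limit at \<open>0\<close> of the difference of the two series divided by \<open>s ^ n\<close>.
\<close>

lemma power_series_coeff_unique:
  fixes a b :: "nat \<Rightarrow> real"
  assumes a: "\<And>n. \<bar>a n\<bar> \<le> c" and b: "\<And>n. \<bar>b n\<bar> \<le> c'"
    and eq: "\<And>s. 0 < s \<Longrightarrow> s < 1 \<Longrightarrow> (\<Sum>n. a n * s ^ n) = (\<Sum>n. b n * s ^ n)"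
  shows "a = b"
proof -
  have smm: "summable (\<lambda>n. u n * s ^ n)" if "\<And>n. \<bar>u n\<bar> \<le> C" "\<bar>s\<bar> < 1" for u C and s :: real
  proof (rule summable_comparison_test'[where g = "\<lambda>n. C * \<bar>s\<bar> ^ n" and N = 0])
    show "summable (\<lambda>n. C * \<bar>s\<bar> ^ n)" using that(2) by (intro summable_mult summable_geometric) simp
    show "norm (u n * s ^ n) \<le> C * \<bar>s\<bar> ^ n" for n
      using mult_right_mono[OF that(1)[of n], of "\<bar>s\<bar> ^ n"] by (simp add: abs_mult power_abs)
  qed
  define d where "d = (\<lambda>n. a n - b n)"
  have d: "\<bar>d n\<bar> \<le> c + c'" for n using a[of n] b[of n] by (auto simp: d_def)
  have d0: "(\<Sum>n. d n * s ^ n) = 0" if "0 < s" "s < 1" for s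
  proof -
    have "(\<Sum>n. a n * s ^ n) - (\<Sum>n. b n * s ^ n) = (\<Sum>n. a n * s ^ n - b n * s ^ n)"
      using smm[OF a, of s] smm[OF b, of s] that by (intro suminf_diff) auto
    then show ?thesis using eq[OF that] by (simp add: d_def left_diff_distrib)
  qed
  have "d n = 0" for n
  proof (induction n rule: less_induct)
    case (less n)
    define f where "f = (\<lambda>x. \<Sum>k. d (k + n) * x ^ k)"
    have f0: "f s = 0" if s: "0 < s" "s < 1" for s
    proof -
      have "(\<Sum>k. d k * s ^ k) = (\<Sum>k. d (k + n) * s ^ (k + n)) + (\<Sum>k<n. d k * s ^ k)"
        using smm[OF d, of s] s by (intro suminf_split_initial_segment) auto
      also have "(\<Sum>k<n. d k * s ^ k) = 0" using less by simp
      also have "(\<Sum>k. d (k + n) * s ^ (k + n)) = (\<Sum>k. s ^ n * (d (k + n) * s ^ k))"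
        by (simp add: power_add mult_ac)
      also have "\<dots> = s ^ n * f s"
        unfolding f_def using s smm[of "\<lambda>k. d (k + n)" "c + c'" s] d by (intro suminf_mult) auto
      finally show ?thesis using d0[OF s] s by simp
    qed
    have "(f \<longlongrightarrow> d (0 + n)) (at 0)"
      using d by (intro powser_limit_0[where s = 1 and a = "\<lambda>k. d (k + n)"])
        (auto simp: f_def intro!: summable_sums smm[where C = "c + c'"])
    then have "(f \<longlongrightarrow> d n) (at_right 0)" by (simp add: filterlim_at_split)
    moreover have "(f \<longlongrightarrow> 0) (at_right 0)"
      by (rule tendsto_eventually, unfold eventually_at_right_field)
        (intro exI[of _ 1], use f0 in auto)
    ultimately show "d n = 0"
      by (meson tendsto_unique trivial_limit_at_right_real)
  qed
  then show ?thesis by (auto simp: d_def)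
qed

lemma (in finite_measure) integral_split_nat_sums:
  fixes g :: "'a \<Rightarrow> real"
  assumes g: "integrable M g" and X[measurable]: "X \<in> measurable M (count_space (UNIV :: nat set))"
  shows "(\<lambda>r. \<integral>x. of_bool (X x = r) * g x \<partial>M) sums (\<integral>x. g x \<partial>M)"
proof -
  have [measurable]: "g \<in> borel_measurable M" using g by auto
  have i: "integrable M (\<lambda>x. of_bool (X x = r) * g x)" for r
    by (rule Bochner_Integration.integrable_bound[OF g]) auto
  have eq: "(\<Sum>r<n. of_bool (X x = r) * g x) = of_bool (X x < n) * g x" for n x
    by (simp add: of_bool_def if_distrib[where f = "\<lambda>c. c * g x"] cong: if_cong)
  have "(\<lambda>n. \<integral>x. (\<Sum>r<n. of_bool (X x = r) * g x) \<partial>M) \<longlonglongrightarrow> (\<integral>x. g x \<partial>M)"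
  proof (rule integral_dominated_convergence[where w = "\<lambda>x. \<bar>g x\<bar>"])
    show "AE x in M. (\<lambda>n. \<Sum>r<n. of_bool (X x = r) * g x) \<longlonglongrightarrow> g x"
    proof (rule AE_I2)
      fix x
      show "(\<lambda>n. \<Sum>r<n. of_bool (X x = r) * g x) \<longlonglongrightarrow> g x"
        by (rule tendsto_eventually, rule eventually_sequentiallyI[of "Suc (X x)"])
          (simp only: eq, simp)
    qed
    show "AE x in M. norm (\<Sum>r<n. of_bool (X x = r) * g x) \<le> \<bar>g x\<bar>" for n
      by (simp only: eq) auto
  qed (use g in auto)
  then show ?thesis unfolding sums_def using i by (subst (asm) Bochner_Integration.integral_sum) auto
qed

context prob_space
begin

lemma integral_nat_power_sums:
  fixes W :: "'a \<Rightarrow> real"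
  assumes W: "integrable M W" and X[measurable]: "X \<in> measurable M (count_space (UNIV :: nat set))"
    and s: "0 \<le> s" "s \<le> 1"
  shows "(\<lambda>r. (\<integral>x. of_bool (X x = r) * W x \<partial>M) * s ^ r) sums (\<integral>x. W x * s ^ X x \<partial>M)"
proof -
  have [measurable]: "W \<in> borel_measurable M" using W by auto
  have "integrable M (\<lambda>x. W x * s ^ X x)"
    using s by (intro Bochner_Integration.integrable_bound[OF W])
      (auto simp: abs_mult power_le_one intro!: mult_left_le)
  from integral_split_nat_sums[OF this X]
  have "(\<lambda>r. \<integral>x. of_bool (X x = r) * (W x * s ^ X x) \<partial>M) sums (\<integral>x. W x * s ^ X x \<partial>M)" .
  moreover have "(\<integral>x. of_bool (X x = r) * (W x * s ^ X x) \<partial>M) = (\<integral>x. of_bool (X x = r) * W x \<partial>M) * s ^ r" for r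
  proof -
    have "(\<integral>x. of_bool (X x = r) * (W x * s ^ X x) \<partial>M) = (\<integral>x. (of_bool (X x = r) * W x) * s ^ r \<partial>M)"
      by (intro Bochner_Integration.integral_cong) auto
    then show ?thesis by simp
  qed
  ultimately show ?thesis by simp
qed

text \<open>
  The variables are inverted one at a time. The induction over \<open>D\<close> shows the mixed formula in which
  the coordinates in \<open>D\<close> are already fixed to a value while the others still enter through their
  generating functions. Passing from \<open>D\<close> to \<open>insert d D\<close> compares the coefficients of two power
  series in the single variable \<open>s d\<close>. Having every \<open>D \<subseteq> K\<close>, and not just \<open>K\<close>, in the conclusion
  gives the marginal laws as well.
\<close>

lemma joint_poisson_of_pgf:
  fixes X :: "'k \<Rightarrow> 'a \<Rightarrow> nat"
  assumes K: "finite K" and X[measurable]: "\<And>k. k \<in> K \<Longrightarrow> X k \<in> measurable M (count_space UNIV)"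
    and l: "\<And>k. k \<in> K \<Longrightarrow> 0 \<le> l k"
    and pgf: "\<And>s. (\<And>k. 0 \<le> s k \<and> s k \<le> (1::real)) \<Longrightarrow>
       (\<integral>\<omega>. (\<Prod>k\<in>K. s k ^ X k \<omega>) \<partial>M) = (\<Prod>k\<in>K. exp (- (1 - s k) * l k))"
    and D: "D \<subseteq> K"
  shows "prob {\<omega>\<in>space M. \<forall>k\<in>D. X k \<omega> = r k} = (\<Prod>k\<in>D. poisson_weight (l k) (r k))"
proof -
  have "(\<integral>\<omega>. (\<Prod>k\<in>D. of_bool (X k \<omega> = r k)) * (\<Prod>k\<in>K - D. s k ^ X k \<omega>) \<partial>M) =
      (\<Prod>k\<in>D. poisson_weight (l k) (r k)) * (\<Prod>k\<in>K - D. exp (- (1 - s k) * l k))"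
    if "\<And>k. 0 \<le> s k \<and> s k \<le> (1::real)" for s
    using finite_subset[OF D K] D that
  proof (induction D arbitrary: s rule: finite_induct)
    case empty
    then show ?case using pgf[of s] by simp
  next
    case (insert d D)
    let ?W = "\<lambda>\<omega>. (\<Prod>k\<in>D. of_bool (X k \<omega> = r k)) * (\<Prod>k\<in>K - insert d D. s k ^ X k \<omega>)"
    let ?c = "(\<Prod>k\<in>D. poisson_weight (l k) (r k)) * (\<Prod>k\<in>K - insert d D. exp (- (1 - s k) * l k))"
    have [measurable]: "X d \<in> measurable M (count_space UNIV)" using X insert by auto
    have [measurable]: "?W \<in> borel_measurable M"
      using insert.prems by (intro borel_measurable_times borel_measurable_prod) (auto intro: X)
    have W01: "0 \<le> ?W \<omega>" "?W \<omega> \<le> 1" for \<omega>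
      using insert.prems
      by (auto intro!: mult_nonneg_nonneg prod_nonneg mult_le_one prod_le_1 power_le_one)
    have Wi: "integrable M ?W"
    proof (rule integrable_const_bound[where B = 1])
      show "AE \<omega> in M. norm (?W \<omega>) \<le> 1"
        using W01 by (intro AE_I2) (simp only: real_norm_def abs_of_nonneg)
    qed simp
    have diff: "K - D = insert d (K - insert d D)" using insert by auto
    define a where "a = (\<lambda>j. \<integral>\<omega>. of_bool (X d \<omega> = j) * ?W \<omega> \<partial>M)"
    define b where "b = (\<lambda>j. ?c * poisson_weight (l d) j)"
    have ld: "0 \<le> l d" using l insert by auto
    have c01: "0 \<le> ?c" "?c \<le> 1"
      using insert.prems l poisson_weight_bounds
      by (auto intro!: mult_nonneg_nonneg prod_nonneg mult_le_one prod_le_1 mult_nonpos_nonneg)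
    have "a = b"
    proof (rule power_series_coeff_unique)
      show "\<bar>a j\<bar> \<le> 1" for j
      proof -
        have "integrable M (\<lambda>\<omega>. of_bool (X d \<omega> = j) * ?W \<omega>)"
          by (rule Bochner_Integration.integrable_bound[OF Wi]) auto
        then have "a j \<le> (\<integral>\<omega>. 1 \<partial>M)" unfolding a_def
        proof (rule integral_mono)
          show "of_bool (X d \<omega> = j) * ?W \<omega> \<le> 1" for \<omega>
            using W01[of \<omega>] by (cases "X d \<omega> = j") simp_all
        qed simp
        moreover have "0 \<le> a j" unfolding a_def using W01 by (intro integral_nonneg_AE) auto
        ultimately show ?thesis by (simp add: prob_space)
      qed
      show "\<bar>b j\<bar> \<le> 1" for j
      proof -
        have "0 \<le> b j"
          unfolding b_def by (rule mult_nonneg_nonneg[OF c01(1) poisson_weight_bounds(1)[OF ld]])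
        moreover have "b j \<le> 1"
          unfolding b_def using poisson_weight_bounds[OF ld] by (rule mult_le_one[OF c01(2)])
        ultimately show ?thesis by simp
      qed
      fix z :: real assume z: "0 < z" "z < 1"
      have "(\<lambda>j. a j * z ^ j) sums (\<integral>\<omega>. ?W \<omega> * z ^ X d \<omega> \<partial>M)"
        unfolding a_def using integral_nat_power_sums[OF Wi, of "X d" z] z by simp
      moreover have "(\<lambda>j. b j * z ^ j) sums (?c * exp (- (1 - z) * l d))"
        unfolding b_def mult.assoc by (intro sums_mult) (use poisson_weight_pgf in simp)
      moreover have "(\<integral>\<omega>. ?W \<omega> * z ^ X d \<omega> \<partial>M) = ?c * exp (- (1 - z) * l d)"
      proof -
        have p1: "(\<Prod>k\<in>K - insert d D. (s(d := z)) k ^ X k \<omega>) = (\<Prod>k\<in>K - insert d D. s k ^ X k \<omega>)" for \<omega>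
          by (intro prod.cong) auto
        have p2: "(\<Prod>k\<in>K - insert d D. exp (- (1 - (s(d := z)) k) * l k)) =
           (\<Prod>k\<in>K - insert d D. exp (- (1 - s k) * l k))"
          by (intro prod.cong) auto
        have "(\<integral>\<omega>. (\<Prod>k\<in>D. of_bool (X k \<omega> = r k)) * (\<Prod>k\<in>K - D. (s(d := z)) k ^ X k \<omega>) \<partial>M) =
          (\<Prod>k\<in>D. poisson_weight (l k) (r k)) * (\<Prod>k\<in>K - D. exp (- (1 - (s(d := z)) k) * l k))"
          using insert.prems z by (intro insert.IH) auto
        then show ?thesis
          unfolding diff using K
          by (simp add: p1[unfolded fun_upd_def] p2[unfolded fun_upd_def] fun_upd_def mult_ac)
      qed
      ultimately show "(\<Sum>j. a j * z ^ j) = (\<Sum>j. b j * z ^ j)" by (simp add: sums_iff)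
    qed
    then have "a (r d) = b (r d)" by simp
    then show ?case using insert.hyps by (simp add: a_def b_def mult_ac)
  qed
  from this[of "\<lambda>_. 1"]
  have "(\<integral>\<omega>. (\<Prod>k\<in>D. of_bool (X k \<omega> = r k)) \<partial>M) = (\<Prod>k\<in>D. poisson_weight (l k) (r k))"
    by simp
  moreover have "(\<integral>\<omega>. (\<Prod>k\<in>D. of_bool (X k \<omega> = r k)) \<partial>M) =
     (\<integral>\<omega>. indicator {\<omega>\<in>space M. \<forall>k\<in>D. X k \<omega> = r k} \<omega> \<partial>M :: real)"
    using finite_subset[OF D K]
    by (intro Bochner_Integration.integral_cong) (auto simp: indicator_def prod.neutral)
  moreover have "{\<omega>\<in>space M. \<forall>k\<in>D. X k \<omega> = r k} \<in> sets M"
  proof -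
    note [measurable] = X[OF subsetD[OF D]]
    show ?thesis using finite_subset[OF D K] by measurable
  qed
  ultimately show ?thesis by simp
qed

text \<open>
  Singletons together with the whole space form an intersection-stable generator of the discrete
  sigma-algebra on \<^typ>\<open>nat\<close>. Components with the whole space are dropped from the event, which is
  why the hypothesis speaks of all subsets \<open>D\<close> of \<open>K\<close>.
\<close>

lemma indep_vars_of_joint_weights:
  fixes X :: "'k \<Rightarrow> 'a \<Rightarrow> nat"
  assumes K: "finite K" "K \<noteq> {}" and X[measurable]: "\<And>k. k \<in> K \<Longrightarrow> X k \<in> measurable M (count_space UNIV)"
    and joint: "\<And>D r. D \<subseteq> K \<Longrightarrow> prob {\<omega>\<in>space M. \<forall>k\<in>D. X k \<omega> = r k} = (\<Prod>k\<in>D. w k (r k))"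
  shows "indep_vars (\<lambda>_. count_space UNIV) X K"
proof (subst indep_vars_finite[where E = "\<lambda>_. {UNIV, {}} \<union> range (\<lambda>r. {r})"])
  show "sets (count_space UNIV) = sigma_sets (space (count_space UNIV)) ({UNIV, {}} \<union> range (\<lambda>r::nat. {r}))"
  proof -
    have "A \<in> sigma_sets UNIV ({UNIV, {}} \<union> range (\<lambda>r::nat. {r}))" for A :: "nat set"
    proof -
      have "(\<Union>a\<in>A. {a}) \<in> sigma_sets UNIV ({UNIV, {}} \<union> range (\<lambda>r::nat. {r}))"
        by (rule sigma_sets_UNION) auto
      then show ?thesis by simp
    qed
    then show ?thesis by auto
  qed
  show "Int_stable ({UNIV, {}} \<union> range (\<lambda>r::nat. {r}))"
    by (auto simp: Int_stable_def)
  show "\<forall>A\<in>(\<Pi> i\<in>K. {UNIV, {}} \<union> range (\<lambda>r. {r})).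
     prob (\<Inter>j\<in>K. X j -` A j \<inter> space M) = (\<Prod>j\<in>K. prob (X j -` A j \<inter> space M))"
  proof
    fix A :: "'k \<Rightarrow> nat set" assume A: "A \<in> (\<Pi> i\<in>K. {UNIV, {}} \<union> range (\<lambda>r. {r}))"
    show "prob (\<Inter>j\<in>K. X j -` A j \<inter> space M) = (\<Prod>j\<in>K. prob (X j -` A j \<inter> space M))"
    proof (cases "\<exists>k\<in>K. A k = {}")
      case True
      then obtain k where k: "k \<in> K" "A k = {}" by auto
      then have "(\<Inter>j\<in>K. X j -` A j \<inter> space M) = {}" by auto
      moreover have "(\<Prod>j\<in>K. prob (X j -` A j \<inter> space M)) = 0"
        using K k by (intro prod_zero bexI[of _ k]) auto
      ultimately show ?thesis by simp
    next
      case False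
      define D where "D = {k\<in>K. A k \<noteq> UNIV}"
      define r where "r = (\<lambda>k. SOME x. A k = {x})"
      have D: "D \<subseteq> K" by (auto simp: D_def)
      have r: "A k = {r k}" if "k \<in> D" for k
      proof -
        have "\<exists>x. A k = {x}" using that A False by (auto simp: D_def)
        then show ?thesis unfolding r_def by (rule someI_ex)
      qed
      have U: "A k = UNIV" if "k \<in> K - D" for k using that by (auto simp: D_def)
      have "(\<Inter>j\<in>K. X j -` A j \<inter> space M) = {\<omega>\<in>space M. \<forall>k\<in>D. X k \<omega> = r k}"
      proof (intro equalityI subsetI)
        fix \<omega> assume "\<omega> \<in> (\<Inter>j\<in>K. X j -` A j \<inter> space M)"
        then show "\<omega> \<in> {\<omega>\<in>space M. \<forall>k\<in>D. X k \<omega> = r k}" using K D r by fastforce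
      next
        fix \<omega> assume \<omega>: "\<omega> \<in> {\<omega>\<in>space M. \<forall>k\<in>D. X k \<omega> = r k}"
        have "X k \<omega> \<in> A k" if "k \<in> K" for k
          using \<omega> r[of k] U[of k] that by (cases "k \<in> D") auto
        then show "\<omega> \<in> (\<Inter>j\<in>K. X j -` A j \<inter> space M)" using \<omega> by auto
      qed
      then have "prob (\<Inter>j\<in>K. X j -` A j \<inter> space M) = (\<Prod>k\<in>D. w k (r k))"
        using joint[OF D] by simp
      also have "\<dots> = (\<Prod>k\<in>D. prob (X k -` A k \<inter> space M))"
      proof (intro prod.cong refl)
        fix k assume k: "k \<in> D"
        then have "X k -` A k \<inter> space M = {\<omega>\<in>space M. \<forall>k\<in>{k}. X k \<omega> = r k}" using r by auto
        then show "w k (r k) = prob (X k -` A k \<inter> space M)"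
          using joint[of "{k}" r] k D by auto
      qed
      also have "\<dots> = (\<Prod>k\<in>K. prob (X k -` A k \<inter> space M))"
        using K D U by (intro prod.mono_neutral_left) (auto simp: prob_space)
      finally show ?thesis .
    qed
  qed
qed (use K X in auto)

text \<open>
  Independence is a statement about the joint distribution, which ignores null sets.
\<close>

lemma indep_vars_AE_cong:
  assumes I: "I \<noteq> {}" "finite I" and X: "indep_vars M' X I"
    and Y: "\<And>i. i \<in> I \<Longrightarrow> Y i \<in> measurable M (M' i)"
    and eq: "\<And>i. i \<in> I \<Longrightarrow> AE \<omega> in M. X i \<omega> = Y i \<omega>"
  shows "indep_vars M' Y I"
proof -
  have X': "\<And>i. i \<in> I \<Longrightarrow> X i \<in> measurable M (M' i)" using X by (auto simp: indep_vars_def)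
  have "AE \<omega> in M. \<forall>i\<in>I. X i \<omega> = Y i \<omega>" using I eq by (intro AE_finite_allI) auto
  then have "AE \<omega> in M. (\<lambda>i\<in>I. X i \<omega>) = (\<lambda>i\<in>I. Y i \<omega>)" by eventually_elim auto
  then have "distr M (PiM I M') (\<lambda>\<omega>. \<lambda>i\<in>I. Y i \<omega>) = distr M (PiM I M') (\<lambda>\<omega>. \<lambda>i\<in>I. X i \<omega>)"
    using X' Y by (intro distr_cong_AE) (auto intro!: measurable_restrict)
  also have "\<dots> = PiM I (\<lambda>i. distr M (M' i) (X i))"
    using X I X' by (subst (asm) indep_vars_iff_distr_eq_PiM') auto
  also have "\<dots> = PiM I (\<lambda>i. distr M (M' i) (Y i))"
    using X' Y eq by (intro PiM_cong refl distr_cong_AE) auto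
  finally show ?thesis using I Y by (subst indep_vars_iff_distr_eq_PiM') auto
qed

end

section \<open>Counts of a Poisson process\<close>

text \<open>
  Counts of a point process are extended nonnegative reals. Powers \<open>s ^ nat_count c\<close> make sense for
  them, at the price of the junk value \<open>nat_count \<infinity> = 0\<close>; it is harmless because infinite counts
  have probability zero whenever the intensity is finite.
\<close>

definition nat_count :: "ennreal \<Rightarrow> nat" where
  "nat_count c = nat \<lfloor>enn2real c\<rfloor>"

lemma nat_count_of_nat [simp]: "nat_count (of_nat k) = k"
  unfolding nat_count_def by (simp add: ennreal_of_nat_eq_real_of_nat)

lemma measurable_nat_count [measurable]: "nat_count \<in> measurable borel (count_space UNIV)"
  unfolding nat_count_def by measurable

lemma nat_count_emeasure_count_space [simp]:
  "nat_count (emeasure (count_space UNIV) S) = card S"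
  by (cases "finite S") (auto simp: nat_count_def ennreal_of_nat_eq_real_of_nat)

lemma of_nat_nat_count:
  assumes "c \<in> range ennreal_of_enat" "c < \<infinity>"
  shows "of_nat (nat_count c) = c"
proof -
  obtain e where e: "c = ennreal_of_enat e" using assms by auto
  with assms obtain k where "e = enat k" by (cases e) auto
  with e show ?thesis by simp
qed

lemma measurable_emeasure_process:
  assumes "point_process P M \<Xi>" "A \<in> sets M"
  shows "(\<lambda>\<omega>. emeasure (\<Xi> \<omega>) A) \<in> borel_measurable P"
  using assms by (auto simp: point_process_def)

lemma poisson_process_weight:
  assumes "poisson_point_process P \<Lambda> \<Xi>" "A \<in> sets \<Lambda>" "emeasure \<Lambda> A < \<infinity>"
  shows "measure P {\<omega>\<in>space P. emeasure (\<Xi> \<omega>) A = of_nat k} = poisson_weight (measure \<Lambda> A) k"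
  using assms by (auto simp: poisson_point_process_def poisson_weight_def)

text \<open>
  The Poisson weights of the finite counts already add up to \<open>1\<close>.
\<close>

lemma poisson_process_AE_finite:
  assumes pp: "poisson_point_process P \<Lambda> \<Xi>" and A: "A \<in> sets \<Lambda>" "emeasure \<Lambda> A < \<infinity>"
  shows "AE \<omega> in P. emeasure (\<Xi> \<omega>) A < \<infinity>"
proof -
  interpret prob_space P using pp by (simp add: poisson_point_process_def)
  have [measurable]: "(\<lambda>\<omega>. emeasure (\<Xi> \<omega>) A) \<in> borel_measurable P"
    using pp A by (auto simp: poisson_point_process_def intro: measurable_emeasure_process)
  let ?E = "\<lambda>k::nat. {\<omega>\<in>space P. emeasure (\<Xi> \<omega>) A = of_nat k}"
  have "(\<lambda>k. prob (?E k)) sums prob (\<Union>k. ?E k)"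
    by (rule finite_measure_UNION) (auto simp: disjoint_family_on_def)
  moreover have "(\<lambda>k. prob (?E k)) sums 1"
    using poisson_weight_pgf[of "measure \<Lambda> A" 1] poisson_process_weight[OF pp A] by simp
  ultimately have "prob (\<Union>k. ?E k) = 1" by (rule sums_unique2)
  then have "AE \<omega> in P. \<omega> \<in> (\<Union>k. ?E k)" by (intro AE_prob_1)
  then show ?thesis by eventually_elim (auto simp: less_top[symmetric])
qed

lemma poisson_process_AE_nat_count:
  assumes pp: "poisson_point_process P \<Lambda> \<Xi>" and A: "A \<in> sets \<Lambda>" "emeasure \<Lambda> A < \<infinity>"
  shows "AE \<omega> in P. of_nat (nat_count (emeasure (\<Xi> \<omega>) A)) = emeasure (\<Xi> \<omega>) A"
proof -
  have "emeasure (\<Xi> \<omega>) A \<in> range ennreal_of_enat" if "\<omega> \<in> space P" for \<omega>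
    using pp A that by (auto simp: poisson_point_process_def point_process_def)
  note range = this
  show ?thesis
    using poisson_process_AE_finite[OF assms] AE_space
    by eventually_elim (auto intro: of_nat_nat_count range)
qed

lemma poisson_process_pgf:
  fixes s :: "nat \<Rightarrow> real"
  assumes pp: "poisson_point_process P \<Lambda> \<Xi>"
    and A: "\<And>k. k < m \<Longrightarrow> A k \<in> sets \<Lambda>" "\<And>k. k < m \<Longrightarrow> emeasure \<Lambda> (A k) < \<infinity>"
    and disj: "disjoint_family_on A {..<m}"
    and s: "\<And>k. k < m \<Longrightarrow> 0 \<le> s k" "\<And>k. k < m \<Longrightarrow> s k \<le> 1"
  shows "(\<integral>\<omega>. (\<Prod>k<m. s k ^ nat_count (emeasure (\<Xi> \<omega>) (A k))) \<partial>P) =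
    (\<Prod>k<m. exp (- (1 - s k) * measure \<Lambda> (A k)))"
proof -
  interpret prob_space P using pp by (simp add: poisson_point_process_def)
  have meas: "(\<lambda>\<omega>. emeasure (\<Xi> \<omega>) (A k)) \<in> borel_measurable P" if "k < m" for k
    using pp A that by (auto simp: poisson_point_process_def intro: measurable_emeasure_process)
  have pm: "(\<lambda>c. s k ^ nat_count c) \<in> borel_measurable borel" for k by measurable
  have "indep_vars (\<lambda>_. borel) (\<lambda>k \<omega>. emeasure (\<Xi> \<omega>) (A k)) {..<m}"
    using pp A(1) disj by (auto simp: poisson_point_process_def)
  then have "indep_vars (\<lambda>_. borel) (\<lambda>k \<omega>. s k ^ nat_count (emeasure (\<Xi> \<omega>) (A k))) {..<m}"
    by (rule indep_vars_compose2) (rule pm)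
  then have "(\<integral>\<omega>. (\<Prod>k<m. s k ^ nat_count (emeasure (\<Xi> \<omega>) (A k))) \<partial>P) =
     (\<Prod>k<m. \<integral>\<omega>. s k ^ nat_count (emeasure (\<Xi> \<omega>) (A k)) \<partial>P)"
  proof (rule indep_vars_lebesgue_integral[rotated])
    fix k assume "k \<in> {..<m}"
    then show "integrable P (\<lambda>\<omega>. s k ^ nat_count (emeasure (\<Xi> \<omega>) (A k)))"
      using s measurable_compose[OF meas pm]
      by (intro integrable_const_bound[where B = 1]) (auto simp: power_le_one)
  qed simp
  also have "\<dots> = (\<Prod>k<m. exp (- (1 - s k) * measure \<Lambda> (A k)))"
  proof (intro prod.cong refl)
    fix k assume "k \<in> {..<m}"
    then have k: "k < m" by simp
    note [measurable] = meas[OF k]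
    let ?X = "\<lambda>\<omega>. nat_count (emeasure (\<Xi> \<omega>) (A k))"
    have "(\<integral>\<omega>. of_bool (?X \<omega> = r) * 1 \<partial>P) = poisson_weight (measure \<Lambda> (A k)) r" for r
    proof -
      have "(\<integral>\<omega>. of_bool (?X \<omega> = r) * 1 \<partial>P) = (\<integral>\<omega>. indicator {\<omega>\<in>space P. ?X \<omega> = r} \<omega> \<partial>P :: real)"
        by (intro Bochner_Integration.integral_cong) (auto simp: indicator_def)
      also have "\<dots> = prob {\<omega>\<in>space P. ?X \<omega> = r}" by simp
      also have "\<dots> = prob {\<omega>\<in>space P. emeasure (\<Xi> \<omega>) (A k) = of_nat r}"
      proof (intro prob_eq_AE)
        show "AE \<omega> in P. (?X \<omega> = r) = (emeasure (\<Xi> \<omega>) (A k) = of_nat r)"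
          using poisson_process_AE_nat_count[OF pp A(1)[OF k] A(2)[OF k]]
          by eventually_elim (metis nat_count_of_nat)
      qed measurable
      also have "\<dots> = poisson_weight (measure \<Lambda> (A k)) r"
        by (rule poisson_process_weight[OF pp A(1)[OF k] A(2)[OF k]])
      finally show ?thesis .
    qed
    then have "(\<lambda>r. poisson_weight (measure \<Lambda> (A k)) r * s k ^ r) sums (\<integral>\<omega>. s k ^ ?X \<omega> \<partial>P)"
      using integral_nat_power_sums[of "\<lambda>_. 1" ?X "s k"] s[OF k] by simp
    then show "(\<integral>\<omega>. s k ^ ?X \<omega> \<partial>P) = exp (- (1 - s k) * measure \<Lambda> (A k))"
      using poisson_weight_pgf sums_unique2 by blast
  qed
  finally show ?thesis .
qed

text \<open>
  The converse of \<open>poisson_process_pgf\<close>: the joint generating functions of the counts on disjoint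
  regions characterise a Poisson process of finite intensity. The counts are first shown to be
  independent as natural numbers and then identified, up to null sets, with the extended ones.
\<close>

lemma poisson_point_processI_pgf:
  assumes "prob_space P" and fin: "finite_measure \<Lambda>" and pp: "point_process P \<Lambda> \<Xi>"
    and AE_fin: "\<And>A. A \<in> sets \<Lambda> \<Longrightarrow> AE \<omega> in P. emeasure (\<Xi> \<omega>) A < \<infinity>"
    and pgf: "\<And>(m::nat) A s. (\<And>k. k < m \<Longrightarrow> A k \<in> sets \<Lambda>) \<Longrightarrow> disjoint_family_on A {..<m} \<Longrightarrow>
      (\<And>k. 0 \<le> s k \<and> s k \<le> (1::real)) \<Longrightarrow>
      (\<integral>\<omega>. (\<Prod>k<m. s k ^ nat_count (emeasure (\<Xi> \<omega>) (A k))) \<partial>P) =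
      (\<Prod>k<m. exp (- (1 - s k) * measure \<Lambda> (A k)))"
  shows "poisson_point_process P \<Lambda> \<Xi>"
proof -
  interpret prob_space P by fact
  interpret \<Lambda>: finite_measure \<Lambda> by fact
  have meas[measurable]: "(\<lambda>\<omega>. emeasure (\<Xi> \<omega>) A) \<in> borel_measurable P" if "A \<in> sets \<Lambda>" for A
    using measurable_emeasure_process[OF pp that] .
  have cnt: "AE \<omega> in P. of_nat (nat_count (emeasure (\<Xi> \<omega>) A)) = emeasure (\<Xi> \<omega>) A" if A: "A \<in> sets \<Lambda>" for A
  proof -
    have "emeasure (\<Xi> \<omega>) A \<in> range ennreal_of_enat" if "\<omega> \<in> space P" for \<omega>
      using pp A that by (auto simp: point_process_def)
    note range = this
    show ?thesis
      using AE_fin[OF A] AE_space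
      by eventually_elim (auto intro: of_nat_nat_count range)
  qed
  have joint: "prob {\<omega>\<in>space P. \<forall>k\<in>D. nat_count (emeasure (\<Xi> \<omega>) (A k)) = r k} =
      (\<Prod>k\<in>D. poisson_weight (measure \<Lambda> (A k)) (r k))"
    if "\<And>k. k < m \<Longrightarrow> A k \<in> sets \<Lambda>" "disjoint_family_on A {..<m}" "D \<subseteq> {..<m}" for m :: nat and A D r
    using that pgf[of m A]
    by (intro joint_poisson_of_pgf[where K = "{..<m}"]) (auto intro!: measurable_compose[OF meas])
  show ?thesis
    unfolding poisson_point_process_def
  proof (intro conjI ballI impI allI)
    show "prob_space P" "point_process P \<Lambda> \<Xi>" by fact+
  next
    fix A k assume A: "A \<in> sets \<Lambda>"
    have "measure P {\<omega>\<in>space P. emeasure (\<Xi> \<omega>) A = of_nat k} =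
       prob {\<omega>\<in>space P. nat_count (emeasure (\<Xi> \<omega>) A) = k}"
    proof (intro prob_eq_AE)
      show "AE \<omega> in P. (emeasure (\<Xi> \<omega>) A = of_nat k) = (nat_count (emeasure (\<Xi> \<omega>) A) = k)"
        using cnt[OF A] by eventually_elim (metis nat_count_of_nat)
    qed (use A in measurable)
    also have "\<dots> = poisson_weight (measure \<Lambda> A) k"
      using joint[of 1 "\<lambda>_. A" "{0}" "\<lambda>_. k"] A by (simp add: disjoint_family_on_def)
    finally show "measure P {\<omega>\<in>space P. emeasure (\<Xi> \<omega>) A = of_nat k} =
       measure \<Lambda> A ^ k / fact k * exp (- measure \<Lambda> A)" by (simp add: poisson_weight_def)
  next
    fix A assume "A \<in> sets \<Lambda>" "emeasure \<Lambda> A = \<infinity>"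
    then show "AE \<omega> in P. emeasure (\<Xi> \<omega>) A = \<infinity>" using \<Lambda>.emeasure_finite by auto
  next
    fix m :: nat and A assume A: "(\<forall>k<m. A k \<in> sets \<Lambda>) \<and> disjoint_family_on A {..<m}"
    show "indep_vars (\<lambda>_. borel) (\<lambda>k \<omega>. emeasure (\<Xi> \<omega>) (A k)) {..<m}"
    proof (cases "m = 0")
      case True
      then show ?thesis by (simp add: indep_vars_def2 indep_sets_def)
    next
      case False
      then have ne: "{..<m} \<noteq> {}" by auto
      have "indep_vars (\<lambda>_. count_space UNIV) (\<lambda>k \<omega>. nat_count (emeasure (\<Xi> \<omega>) (A k))) {..<m}"
        using A ne joint[of m A]
        by (intro indep_vars_of_joint_weights[where w = "\<lambda>k. poisson_weight (measure \<Lambda> (A k))"])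
          (auto intro!: measurable_compose[OF meas])
      then have "indep_vars (\<lambda>_. borel) (\<lambda>k \<omega>. of_nat (nat_count (emeasure (\<Xi> \<omega>) (A k))) :: ennreal) {..<m}"
        by (rule indep_vars_compose2) auto
      then show ?thesis
        using A ne cnt by (elim indep_vars_AE_cong[rotated 2]) auto
    qed
  qed
qed

section \<open>Labelled atoms and the generating functional\<close>

text \<open>
  Each \<open>x i\<close> lies in at most one \<open>A k\<close>, so its factor is \<open>1 - c k\<close> for that \<open>k\<close>, or \<open>1\<close>. Grouping the
  factors by region turns a product over atoms into a product of powers of counts.
\<close>

lemma prod_disjoint_marks:
  fixes c :: "'k \<Rightarrow> real"
  assumes I: "finite I" and K: "finite K" and disj: "disjoint_family_on A K"
  shows "(\<Prod>i\<in>I. 1 - (\<Sum>k\<in>K. c k * indicator (A k) (x i))) =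
    (\<Prod>k\<in>K. (1 - c k) ^ card {i\<in>I. x i \<in> A k})"
proof -
  have "1 - (\<Sum>k\<in>K. c k * indicator (A k) z) = (\<Prod>k\<in>K. if z \<in> A k then 1 - c k else 1)" for z
  proof (cases "\<exists>k\<in>K. z \<in> A k")
    case True
    then obtain l where l: "l \<in> K" "z \<in> A l" by auto
    then have iff: "z \<in> A k \<longleftrightarrow> k = l" if "k \<in> K" for k
      using disj that by (auto simp: disjoint_family_on_def)
    have "(\<Sum>k\<in>K. c k * indicator (A k) z) = (\<Sum>k\<in>K. if k = l then c k else 0)"
      by (intro sum.cong) (auto simp: iff)
    moreover have "(\<Prod>k\<in>K. if z \<in> A k then 1 - c k else 1) = (\<Prod>k\<in>K. if k = l then 1 - c k else 1)"
      by (intro prod.cong) (auto simp: iff)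
    ultimately show ?thesis using l K by (simp add: sum.delta prod.delta)
  next
    case False
    then have "(\<Sum>k\<in>K. c k * indicator (A k) z) = 0" by (intro sum.neutral) auto
    moreover have "(\<Prod>k\<in>K. if z \<in> A k then 1 - c k else 1) = 1"
      using False by (intro prod.neutral) auto
    ultimately show ?thesis by simp
  qed
  then have "(\<Prod>i\<in>I. 1 - (\<Sum>k\<in>K. c k * indicator (A k) (x i))) =
      (\<Prod>k\<in>K. \<Prod>i\<in>I. if x i \<in> A k then 1 - c k else 1)"
    by (simp add: prod.swap[of _ K I])
  also have "\<dots> = (\<Prod>k\<in>K. (1 - c k) ^ card {i\<in>I. x i \<in> A k})"
  proof (intro prod.cong refl)
    fix k
    have "(\<Prod>i\<in>I. if x i \<in> A k then 1 - c k else 1) = (\<Prod>i\<in>{i\<in>I. x i \<in> A k}. 1 - c k)"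
      using I by (rule prod.inter_filter[symmetric])
    then show "(\<Prod>i\<in>I. if x i \<in> A k then 1 - c k else 1) = (1 - c k) ^ card {i\<in>I. x i \<in> A k}"
      by simp
  qed
  finally show ?thesis .
qed

lemma emeasure_sum_dirac:
  assumes "A \<in> sets M" "\<And>i. i \<in> I \<Longrightarrow> x i \<in> space M"
  shows "emeasure (sum_dirac M I x) A = emeasure (count_space UNIV) {i\<in>I. x i \<in> A}"
proof -
  have "emeasure (sum_dirac M I x) A = emeasure (count_space I) (x -` A \<inter> I)"
    unfolding sum_dirac_def using assms by (subst emeasure_distr) auto
  also have "x -` A \<inter> I = {i\<in>I. x i \<in> A}" by auto
  finally show ?thesis by (simp add: emeasure_count_space)
qed

text \<open>
  Atoms are listed as \<open>Q 0, Q 1, \<dots>\<close>, and those with index below \<open>N\<close> count. The order of the list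
  may depend on the configuration in any measurable way; the arguments below use only products
  over all atoms, which are insensitive to it. If \<open>N = \<infinity>\<close>, such a product is over an infinite index
  set and equals \<open>1\<close> by convention.
\<close>

locale labelled_atoms = prob_space P for P :: "'w measure" +
  fixes M :: "'x measure" and N :: "'w \<Rightarrow> enat" and Q :: "nat \<Rightarrow> 'w \<Rightarrow> 'x"
  assumes N[measurable]: "N \<in> measurable P (count_space UNIV)"
    and Q[measurable]: "\<And>i. Q i \<in> measurable P M"
begin

lemma Q_space: "\<omega> \<in> space P \<Longrightarrow> Q i \<omega> \<in> space M"
  using Q by (rule measurable_space)

lemma measurable_atom_prod:
  assumes f[measurable]: "\<And>i. f i \<in> borel_measurable P"
  shows "(\<lambda>\<omega>. \<Prod>i | enat i < N \<omega>. f i \<omega> :: real) \<in> borel_measurable P"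
  by (rule measurable_compose_countable[where f = "\<lambda>m \<omega>. \<Prod>i | enat i < m. f i \<omega>" and g = N])
    (use f in auto)

lemma atom_prod_bounds:
  assumes f: "\<And>i. enat i < N \<omega> \<Longrightarrow> 0 \<le> f i \<and> f i \<le> (1::real)"
  shows "0 \<le> (\<Prod>i | enat i < N \<omega>. f i)" "(\<Prod>i | enat i < N \<omega>. f i) \<le> 1"
  using f by (auto intro!: prod_nonneg prod_le_1)

lemma point_process_retained:
  assumes R: "\<And>i. R i \<in> measurable P (count_space (UNIV :: bool set))"
    and \<Lambda>: "sets \<Lambda> = sets M"
    and \<eta>: "\<And>\<omega>. \<omega> \<in> space P \<Longrightarrow> \<eta> \<omega> = sum_dirac M {i. enat i < N \<omega> \<and> R i \<omega>} (\<lambda>i. Q i \<omega>)"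
  shows "point_process P \<Lambda> \<eta>"
  unfolding point_process_def
proof (intro conjI ballI)
  have em: "emeasure (\<eta> \<omega>) A = emeasure (count_space UNIV) {i. (enat i < N \<omega> \<and> R i \<omega>) \<and> Q i \<omega> \<in> A}"
    if "A \<in> sets \<Lambda>" "\<omega> \<in> space P" for A \<omega>
    using that \<Lambda> by (simp add: \<eta> emeasure_sum_dirac Q_space)
  {
    fix \<omega> assume w: "\<omega> \<in> space P"
    show "sets (\<eta> \<omega>) = sets \<Lambda>" using w \<Lambda> by (simp add: \<eta> sum_dirac_def)
    fix A assume A: "A \<in> sets \<Lambda>"
    let ?S = "{i. (enat i < N \<omega> \<and> R i \<omega>) \<and> Q i \<omega> \<in> A}"
    have "emeasure (\<eta> \<omega>) A = ennreal_of_enat (if finite ?S then enat (card ?S) else \<infinity>)"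
      unfolding em[OF A w] by (simp add: emeasure_count_space)
    then show "emeasure (\<eta> \<omega>) A \<in> range ennreal_of_enat" by simp
  next
    fix A assume A: "A \<in> sets \<Lambda>"
    then have [measurable]: "A \<in> sets M" using \<Lambda> by simp
    note [measurable] = R
    have "emeasure (\<eta> \<omega>) A = (\<Sum>i. of_bool ((enat i < N \<omega> \<and> R i \<omega>) \<and> Q i \<omega> \<in> A))"
      if "\<omega> \<in> space P" for \<omega>
    proof -
      let ?S = "{i. (enat i < N \<omega> \<and> R i \<omega>) \<and> Q i \<omega> \<in> A}"
      have "emeasure (count_space UNIV) ?S = (\<integral>\<^sup>+i. indicator ?S i \<partial>count_space UNIV)" by simp
      also have "\<dots> = (\<Sum>i. indicator ?S i)" by (rule nn_integral_count_space_nat)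
      finally show ?thesis by (simp add: em[OF A that] indicator_def of_bool_def)
    qed
    then show "(\<lambda>\<omega>. emeasure (\<eta> \<omega>) A) \<in> borel_measurable P"
      by (subst measurable_cong) auto
  }
qed

end

locale poisson_atoms = labelled_atoms P M N Q
  for P :: "'w measure" and M :: "'x measure" and N Q +
  fixes \<Lambda> :: "'x measure" and \<Xi> :: "'w \<Rightarrow> 'x measure"
  assumes pp: "poisson_point_process P \<Lambda> \<Xi>"
    and sets_\<Lambda>: "sets \<Lambda> = sets M"
    and finite_\<Lambda>: "emeasure \<Lambda> (space \<Lambda>) \<noteq> \<infinity>"
    and \<Xi>: "\<And>\<omega>. \<omega> \<in> space P \<Longrightarrow> \<Xi> \<omega> = sum_dirac M {i. enat i < N \<omega>} (\<lambda>i. Q i \<omega>)"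
begin

sublocale \<Lambda>: finite_measure \<Lambda>
  by (rule finite_measureI) (rule finite_\<Lambda>[unfolded infinity_ennreal_def[symmetric]])

lemma AE_finitely_many_atoms: "AE \<omega> in P. N \<omega> \<noteq> \<infinity>"
proof -
  have sp: "space \<Lambda> = space M" using sets_\<Lambda> by (rule sets_eq_imp_space_eq)
  have "AE \<omega> in P. emeasure (\<Xi> \<omega>) (space M) < \<infinity>"
    using \<Lambda>.emeasure_finite
    by (intro poisson_process_AE_finite[OF pp]) (auto simp: sp[symmetric] less_top[symmetric])
  moreover have "emeasure (\<Xi> \<omega>) (space M) = emeasure (count_space UNIV) {i. enat i < N \<omega>}"
    if "\<omega> \<in> space P" for \<omega>
    using that by (simp add: \<Xi> emeasure_sum_dirac Q_space)
  ultimately have "AE \<omega> in P. emeasure (count_space UNIV) {i. enat i < N \<omega>} < \<infinity>"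
    by (subst (asm) AE_cong) auto
  then show ?thesis
    by eventually_elim (rule notI, simp add: emeasure_count_space)
qed

lemma finite_atoms: "N \<omega> \<noteq> \<infinity> \<Longrightarrow> finite {i. enat i < N \<omega>}"
  by (cases "N \<omega>") auto

text \<open>
  For a step function the product over the atoms is a product of powers of counts on the steps, so
  its expectation is a joint generating function of independent Poisson variables.
\<close>

lemma poisson_functional_step:
  fixes A :: "nat \<Rightarrow> 'x set" and c :: "nat \<Rightarrow> real"
  assumes A: "\<And>k. k < m \<Longrightarrow> A k \<in> sets M" and disj: "disjoint_family_on A {..<m}"
    and c: "\<And>k. k < m \<Longrightarrow> 0 \<le> c k" "\<And>k. k < m \<Longrightarrow> c k \<le> 1"
  shows "(\<integral>\<omega>. (\<Prod>i | enat i < N \<omega>. 1 - (\<Sum>k<m. c k * indicator (A k) (Q i \<omega>))) \<partial>P) =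
    exp (- (\<integral>q. (\<Sum>k<m. c k * indicator (A k) q) \<partial>\<Lambda>))"
proof -
  note [measurable] = A
  have A': "A k \<in> sets \<Lambda>" if "k < m" for k using that A sets_\<Lambda> by simp
  have ppP: "point_process P \<Lambda> \<Xi>" using pp by (simp add: poisson_point_process_def)
  have "(\<integral>\<omega>. (\<Prod>i | enat i < N \<omega>. 1 - (\<Sum>k<m. c k * indicator (A k) (Q i \<omega>))) \<partial>P) =
      (\<integral>\<omega>. (\<Prod>k<m. (1 - c k) ^ nat_count (emeasure (\<Xi> \<omega>) (A k))) \<partial>P)"
  proof (rule integral_cong_AE)
    show "(\<lambda>\<omega>. \<Prod>i | enat i < N \<omega>. 1 - (\<Sum>k<m. c k * indicator (A k) (Q i \<omega>))) \<in> borel_measurable P"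
      by (rule measurable_atom_prod) measurable
    show "(\<lambda>\<omega>. \<Prod>k<m. (1 - c k) ^ nat_count (emeasure (\<Xi> \<omega>) (A k))) \<in> borel_measurable P"
      using measurable_emeasure_process[OF ppP A'] by measurable
    show "AE \<omega> in P. (\<Prod>i | enat i < N \<omega>. 1 - (\<Sum>k<m. c k * indicator (A k) (Q i \<omega>))) =
        (\<Prod>k<m. (1 - c k) ^ nat_count (emeasure (\<Xi> \<omega>) (A k)))"
      using AE_finitely_many_atoms AE_space
    proof eventually_elim
      case (elim \<omega>)
      have "nat_count (emeasure (\<Xi> \<omega>) (A k)) = card {i\<in>{i. enat i < N \<omega>}. Q i \<omega> \<in> A k}" if "k < m" for k
        using elim that A by (simp add: \<Xi> emeasure_sum_dirac Q_space)
      then show ?case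
        using prod_disjoint_marks[OF finite_atoms[OF elim(1)] _ disj, of c "\<lambda>i. Q i \<omega>"] by simp
    qed
  qed
  also have "\<dots> = (\<Prod>k<m. exp (- (1 - (1 - c k)) * measure \<Lambda> (A k)))"
    using c A' disj \<Lambda>.emeasure_finite
    by (intro poisson_process_pgf[OF pp]) (auto simp: less_top[symmetric])
  also have "\<dots> = exp (- (\<Sum>k<m. c k * measure \<Lambda> (A k)))"
    by (simp add: exp_sum sum_negf[symmetric])
  also have "(\<Sum>k<m. c k * measure \<Lambda> (A k)) = (\<integral>q. (\<Sum>k<m. c k * indicator (A k) q) \<partial>\<Lambda>)"
    using A' \<Lambda>.emeasure_finite by (subst Bochner_Integration.integral_sum) (auto simp: less_top[symmetric])
  finally show ?thesis .
qed

text \<open>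
  The functional extends from step functions by dominated convergence, both products over atoms
  and integrals being bounded by constants on spaces of finite measure. The step functions
  \<open>\<lfloor>(n + 1) v\<rfloor> / (n + 1)\<close> approximate \<open>v\<close> from below, and their level sets come indexed by natural
  numbers, as in the definition of a Poisson process.
\<close>

lemma poisson_functional:
  assumes v[measurable]: "v \<in> borel_measurable M"
    and v01: "\<And>q. q \<in> space M \<Longrightarrow> 0 \<le> v q" "\<And>q. q \<in> space M \<Longrightarrow> v q \<le> (1::real)"
  shows "(\<integral>\<omega>. (\<Prod>i | enat i < N \<omega>. 1 - v (Q i \<omega>)) \<partial>P) = exp (- (\<integral>q. v q \<partial>\<Lambda>))"
proof -
  have sp: "space \<Lambda> = space M" using sets_\<Lambda> by (rule sets_eq_imp_space_eq)
  have [measurable_cong]: "sets \<Lambda> = sets M" by (rule sets_\<Lambda>)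
  \<comment> \<open>The value \<open>v q = 1\<close> lies on step \<open>k = n + 1\<close>, so \<open>n + 2\<close> steps are needed.\<close>
  define A where "A n k = {q\<in>space M. \<lfloor>real (Suc n) * v q\<rfloor> = int k}" for n k
  define w where "w n q = (\<Sum>k<Suc (Suc n). (real k / real (Suc n)) * indicator (A n k) q)" for n q
  have A[measurable]: "A n k \<in> sets M" for n k unfolding A_def by measurable
  have disj: "disjoint_family_on (A n) {..<m}" for n m
    by (auto simp: disjoint_family_on_def A_def)
  have w_meas[measurable]: "w n \<in> borel_measurable M" for n unfolding w_def by measurable
  have w: "w n q = of_int \<lfloor>real (Suc n) * v q\<rfloor> / real (Suc n)" if q: "q \<in> space M" for n q
  proof -
    define l where "l = nat \<lfloor>real (Suc n) * v q\<rfloor>"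
    have l: "\<lfloor>real (Suc n) * v q\<rfloor> = int l" using v01(1)[OF q] by (simp add: l_def)
    have "real (Suc n) * v q \<le> real (Suc n)" using v01(2)[OF q] by (intro mult_left_le) auto
    then have "\<lfloor>real (Suc n) * v q\<rfloor> \<le> int (Suc n)" by linarith
    then have "l < Suc (Suc n)" using l by simp
    moreover have "w n q = (\<Sum>k<Suc (Suc n). if k = l then real k / real (Suc n) else 0)"
      unfolding w_def using q l by (intro sum.cong refl) (auto simp: A_def indicator_def)
    ultimately show ?thesis using l by (simp add: sum.delta del: sum.lessThan_Suc)
  qed
  have w01: "0 \<le> w n q" "w n q \<le> 1" if q: "q \<in> space M" for n q
  proof -
    show "0 \<le> w n q" using v01(1)[OF q] by (simp add: w[OF q])
    have "real (Suc n) * v q \<le> real (Suc n)" using v01(2)[OF q] by (intro mult_left_le) auto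
    then have "of_int \<lfloor>real (Suc n) * v q\<rfloor> \<le> real (Suc n)" by linarith
    then show "w n q \<le> 1" by (simp add: w[OF q] divide_le_eq_1)
  qed
  have w_lim: "(\<lambda>n. w n q) \<longlonglongrightarrow> v q" if q: "q \<in> space M" for q
  proof (rule tendsto_sandwich)
    show "\<forall>\<^sub>F n in sequentially. v q - inverse (real (Suc n)) \<le> w n q"
    proof (rule always_eventually, rule allI)
      fix n
      have "real (Suc n) * v q - 1 \<le> of_int \<lfloor>real (Suc n) * v q\<rfloor>" by linarith
      then have "(real (Suc n) * v q - 1) / real (Suc n) \<le> w n q"
        unfolding w[OF q] by (intro divide_right_mono) auto
      moreover have "(real (Suc n) * v q - 1) / real (Suc n) = v q - inverse (real (Suc n))"
        by (simp add: field_simps)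
      ultimately show "v q - inverse (real (Suc n)) \<le> w n q" by simp
    qed
    show "\<forall>\<^sub>F n in sequentially. w n q \<le> v q"
    proof (rule always_eventually, rule allI)
      fix n
      have "of_int \<lfloor>real (Suc n) * v q\<rfloor> / real (Suc n) \<le> (real (Suc n) * v q) / real (Suc n)"
        by (intro divide_right_mono) auto
      then show "w n q \<le> v q" unfolding w[OF q] by simp
    qed
    show "(\<lambda>n. v q - inverse (real (Suc n))) \<longlonglongrightarrow> v q"
      using tendsto_diff[OF tendsto_const LIMSEQ_inverse_real_of_nat, of "v q"] by simp
  qed simp
  have step: "(\<integral>\<omega>. (\<Prod>i | enat i < N \<omega>. 1 - w n (Q i \<omega>)) \<partial>P) = exp (- (\<integral>q. w n q \<partial>\<Lambda>))" for n
    unfolding w_def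
    by (intro poisson_functional_step disj) auto
  have "(\<lambda>n. \<integral>q. w n q \<partial>\<Lambda>) \<longlonglongrightarrow> (\<integral>q. v q \<partial>\<Lambda>)"
    by (rule integral_dominated_convergence[where w = "\<lambda>_. 1"])
      (use w_lim w01 sp in \<open>auto intro!: AE_I2\<close>)
  then have "(\<lambda>n. exp (- (\<integral>q. w n q \<partial>\<Lambda>))) \<longlonglongrightarrow> exp (- (\<integral>q. v q \<partial>\<Lambda>))"
    by (intro tendsto_exp tendsto_minus)
  moreover have "(\<lambda>n. \<integral>\<omega>. (\<Prod>i | enat i < N \<omega>. 1 - w n (Q i \<omega>)) \<partial>P)
      \<longlonglongrightarrow> (\<integral>\<omega>. (\<Prod>i | enat i < N \<omega>. 1 - v (Q i \<omega>)) \<partial>P)"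
  proof (rule integral_dominated_convergence[where w = "\<lambda>_. 1"])
    show "AE \<omega> in P. (\<lambda>n. \<Prod>i | enat i < N \<omega>. 1 - w n (Q i \<omega>)) \<longlonglongrightarrow> (\<Prod>i | enat i < N \<omega>. 1 - v (Q i \<omega>))"
      by (intro AE_I2 tendsto_prod tendsto_diff tendsto_const w_lim Q_space)
    show "AE \<omega> in P. norm (\<Prod>i | enat i < N \<omega>. 1 - w n (Q i \<omega>)) \<le> 1" for n
    proof (rule AE_I2)
      fix \<omega> assume "\<omega> \<in> space P"
      then show "norm (\<Prod>i | enat i < N \<omega>. 1 - w n (Q i \<omega>)) \<le> 1"
        using atom_prod_bounds[of \<omega> "\<lambda>i. 1 - w n (Q i \<omega>)"] w01[OF Q_space] by auto
    qed
  qed (auto intro!: measurable_atom_prod)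
  ultimately show ?thesis using step LIMSEQ_unique by simp
qed

end

section \<open>Independent thinning\<close>

text \<open>
  Expanding the product over the marks leaves each subset \<open>S\<close> with the single event that all of \<open>S\<close>
  is marked. These events are exactly the ones whose conditional probabilities are prescribed.
\<close>

lemma prod_one_minus_expand:
  fixes f :: "'i \<Rightarrow> real"
  assumes "finite I"
  shows "(\<Prod>i\<in>I. 1 - of_bool (R i) * f i) =
    (\<Sum>S\<in>Pow I. (\<Prod>i\<in>S. - f i) * of_bool (\<forall>i\<in>S. R i))"
proof -
  have "(\<Prod>i\<in>I. 1 - of_bool (R i) * f i) = (\<Prod>i\<in>I. - (of_bool (R i) * f i) + 1)" by simp
  also have "\<dots> = (\<Sum>S\<in>Pow I. (\<Prod>i\<in>S. - (of_bool (R i) * f i)) * (\<Prod>i\<in>I - S. 1))"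
    by (rule prod_add) fact
  also have "\<dots> = (\<Sum>S\<in>Pow I. (\<Prod>i\<in>S. - f i) * of_bool (\<forall>i\<in>S. R i))"
  proof (intro sum.cong refl)
    fix S assume "S \<in> Pow I"
    then have "finite S" using assms finite_subset by auto
    then have "(\<Prod>i\<in>S. of_bool (R i)) = (of_bool (\<forall>i\<in>S. R i) :: real)"
      by (induction S rule: finite_induct) auto
    then show "(\<Prod>i\<in>S. - (of_bool (R i) * f i)) * (\<Prod>i\<in>I - S. 1) =
        (\<Prod>i\<in>S. - f i) * of_bool (\<forall>i\<in>S. R i)"
      using prod.distrib[of "\<lambda>i. - f i" "\<lambda>i. of_bool (R i)" S] by (simp add: mult.commute)
  qed
  finally show ?thesis .
qed

context labelled_atoms
begin

lemma measurable_atoms_pair: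
  "(\<lambda>\<omega>. (N \<omega>, \<lambda>i. Q i \<omega>)) \<in> measurable P (count_space UNIV \<Otimes>\<^sub>M PiM UNIV (\<lambda>_. M))"
  by (intro measurable_Pair N measurable_PiM_single') (auto simp: Q_space)

lemma subalgebra_atom_algebra: "subalgebra P (atom_algebra P M N Q)"
  unfolding subalgebra_def atom_algebra_def
  using sets_image_in_sets[OF refl measurable_atoms_pair] by simp

lemma measurable_atoms_atom_algebra:
  "N \<in> measurable (atom_algebra P M N Q) (count_space UNIV)"
  "Q i \<in> measurable (atom_algebra P M N Q) M"
proof -
  let ?T = "count_space UNIV \<Otimes>\<^sub>M PiM UNIV (\<lambda>_. M) :: (enat \<times> (nat \<Rightarrow> 'x)) measure"
  have *: "(\<lambda>\<omega>. (N \<omega>, \<lambda>i. Q i \<omega>)) \<in> measurable (atom_algebra P M N Q) ?T"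
    unfolding atom_algebra_def
    using measurable_space[OF measurable_atoms_pair] by (intro measurable_vimage_algebra1) auto
  have "(\<lambda>\<omega>. fst (N \<omega>, \<lambda>i. Q i \<omega>)) \<in> measurable (atom_algebra P M N Q) (count_space UNIV)"
    by (rule measurable_compose[OF * measurable_fst])
  then show "N \<in> measurable (atom_algebra P M N Q) (count_space UNIV)" by simp
  have "(\<lambda>\<omega>. snd (N \<omega>, \<lambda>i. Q i \<omega>) i) \<in> measurable (atom_algebra P M N Q) M"
    by (rule measurable_compose[OF measurable_compose[OF * measurable_snd] measurable_component_singleton]) simp
  then show "Q i \<in> measurable (atom_algebra P M N Q) M" by simp
qed

end

text \<open>
  Atom \<open>i\<close> carries a mark \<open>R i\<close>. Given all atoms, the marks of the atoms are independent with success
  probabilities \<open>t (Q i)\<close>. It suffices to prescribe the conditional probability that a finite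
  set of atoms is entirely marked, since inclusion and exclusion yields the other mark patterns.
\<close>

locale poisson_thinning = poisson_atoms P M N Q \<Lambda> \<Xi>
  for P :: "'w measure" and M :: "'x measure" and N Q \<Lambda> \<Xi> +
  fixes R :: "nat \<Rightarrow> 'w \<Rightarrow> bool" and t :: "'x \<Rightarrow> real"
  assumes R[measurable]: "\<And>i. R i \<in> measurable P (count_space UNIV)"
    and t[measurable]: "t \<in> borel_measurable M"
    and t01: "\<And>q. q \<in> space M \<Longrightarrow> 0 \<le> t q" "\<And>q. q \<in> space M \<Longrightarrow> t q \<le> 1"
    and cond: "\<And>I. finite I \<Longrightarrow> AE \<omega> in P. (\<forall>i\<in>I. enat i < N \<omega>) \<longrightarrow>
      real_cond_exp P (atom_algebra P M N Q) (\<lambda>\<omega>'. of_bool (\<forall>i\<in>I. R i \<omega>')) \<omega> = (\<Prod>i\<in>I. t (Q i \<omega>))"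
begin

sublocale atoms: finite_measure_subalgebra P "atom_algebra P M N Q"
  by unfold_locales (rule subalgebra_atom_algebra)

text \<open>
  On the event \<open>N = enat r\<close> all indices in \<open>S\<close> belong to atoms, so the conditional probability of the
  marks is known there; the remaining factors are functions of the atoms and may be pulled out.
\<close>

lemma integral_marked_subset:
  assumes S: "S \<subseteq> {..<r}"
    and h[measurable]: "h \<in> borel_measurable M"
    and h01: "\<And>q. q \<in> space M \<Longrightarrow> 0 \<le> h q" "\<And>q. q \<in> space M \<Longrightarrow> h q \<le> (1::real)"
  shows "(\<integral>\<omega>. of_bool (N \<omega> = enat r) * ((\<Prod>i\<in>S. - h (Q i \<omega>)) * of_bool (\<forall>i\<in>S. R i \<omega>)) \<partial>P) =
    (\<integral>\<omega>. of_bool (N \<omega> = enat r) * (\<Prod>i\<in>S. - (t (Q i \<omega>) * h (Q i \<omega>))) \<partial>P)"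
proof -
  let ?F = "atom_algebra P M N Q"
  have fS: "finite S" using S finite_subset by auto
  define f where "f \<omega> = of_bool (N \<omega> = enat r) * (\<Prod>i\<in>S. - h (Q i \<omega>))" for \<omega>
  define g where "g \<omega> = (of_bool (\<forall>i\<in>S. R i \<omega>) :: real)" for \<omega>
  have fF: "f \<in> borel_measurable ?F"
  proof -
    note [measurable] = measurable_atoms_atom_algebra
    show ?thesis unfolding f_def by measurable
  qed
  have [measurable]: "f \<in> borel_measurable P" unfolding f_def by measurable
  have gP[measurable]: "g \<in> borel_measurable P" unfolding g_def using fS by measurable
  have f1: "\<bar>f \<omega>\<bar> \<le> 1" if "\<omega> \<in> space P" for \<omega>
    unfolding f_def abs_mult abs_prod
    using h01 Q_space[OF that] by (intro mult_le_one prod_le_1 prod_nonneg) auto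
  have int: "integrable P (\<lambda>\<omega>. f \<omega> * g \<omega>)"
  proof (rule integrable_const_bound[where B = 1])
    show "AE \<omega> in P. norm (f \<omega> * g \<omega>) \<le> 1"
      using f1 by (intro AE_I2) (auto simp: g_def)
  qed simp
  have "(\<integral>\<omega>. of_bool (N \<omega> = enat r) * ((\<Prod>i\<in>S. - h (Q i \<omega>)) * of_bool (\<forall>i\<in>S. R i \<omega>)) \<partial>P) =
      (\<integral>\<omega>. f \<omega> * g \<omega> \<partial>P)"
    by (simp add: f_def g_def mult.assoc)
  also have "\<dots> = (\<integral>\<omega>. f \<omega> * real_cond_exp P ?F g \<omega> \<partial>P)"
    by (rule atoms.real_cond_exp_intg(2)[OF int fF gP, symmetric])
  also have "\<dots> = (\<integral>\<omega>. of_bool (N \<omega> = enat r) * (\<Prod>i\<in>S. - (t (Q i \<omega>) * h (Q i \<omega>))) \<partial>P)"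
  proof (rule integral_cong_AE)
    show "AE \<omega> in P. f \<omega> * real_cond_exp P ?F g \<omega> =
        of_bool (N \<omega> = enat r) * (\<Prod>i\<in>S. - (t (Q i \<omega>) * h (Q i \<omega>)))"
      using cond[OF fS]
    proof eventually_elim
      case (elim \<omega>)
      show ?case
      proof (cases "N \<omega> = enat r")
        case True
        then have "real_cond_exp P ?F g \<omega> = (\<Prod>i\<in>S. t (Q i \<omega>))"
          using elim S by (auto simp: g_def[abs_def])
        then show ?thesis using True
          by (simp add: f_def flip: prod.distrib) (simp add: mult.commute)
      qed (simp add: f_def)
    qed
    show "(\<lambda>\<omega>. f \<omega> * real_cond_exp P ?F g \<omega>) \<in> borel_measurable P"
      by (intro borel_measurable_times) auto
  qed measurable
  finally show ?thesis .
qed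

text \<open>
  A product over a random index set is reduced to products over fixed ones by splitting
  according to the number of atoms.
\<close>

lemma integral_atom_prod_sums:
  fixes f :: "nat \<Rightarrow> 'w \<Rightarrow> real"
  assumes f[measurable]: "\<And>i. f i \<in> borel_measurable P"
    and f01: "\<And>i \<omega>. \<omega> \<in> space P \<Longrightarrow> 0 \<le> f i \<omega> \<and> f i \<omega> \<le> 1"
  shows "(\<lambda>r. \<integral>\<omega>. of_bool (N \<omega> = enat r) * (\<Prod>i<r. f i \<omega>) \<partial>P) sums
    (\<integral>\<omega>. (\<Prod>i | enat i < N \<omega>. f i \<omega>) \<partial>P)"
proof -
  have [measurable]: "(\<lambda>\<omega>. \<Prod>i | enat i < N \<omega>. f i \<omega>) \<in> borel_measurable P"
    by (rule measurable_atom_prod) (rule f)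
  define X where "X \<omega> = (case N \<omega> of enat r \<Rightarrow> r | \<infinity> \<Rightarrow> 0)" for \<omega>
  have X[measurable]: "X \<in> measurable P (count_space UNIV)"
    unfolding X_def by (rule measurable_compose[OF N]) simp
  have int: "integrable P (\<lambda>\<omega>. \<Prod>i | enat i < N \<omega>. f i \<omega>)"
  proof (rule integrable_const_bound[where B = 1])
    show "AE \<omega> in P. norm (\<Prod>i | enat i < N \<omega>. f i \<omega>) \<le> 1"
    proof (rule AE_I2)
      fix \<omega> assume "\<omega> \<in> space P"
      then show "norm (\<Prod>i | enat i < N \<omega>. f i \<omega>) \<le> 1"
        using atom_prod_bounds[of \<omega> "\<lambda>i. f i \<omega>"] f01 by auto
    qed
  qed simp
  have "(\<integral>\<omega>. of_bool (X \<omega> = r) * (\<Prod>i | enat i < N \<omega>. f i \<omega>) \<partial>P) =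
      (\<integral>\<omega>. of_bool (N \<omega> = enat r) * (\<Prod>i<r. f i \<omega>) \<partial>P)" for r
  proof (rule integral_cong_AE)
    show "AE \<omega> in P. of_bool (X \<omega> = r) * (\<Prod>i | enat i < N \<omega>. f i \<omega>) =
        of_bool (N \<omega> = enat r) * (\<Prod>i<r. f i \<omega>)"
      using AE_finitely_many_atoms
      by eventually_elim (auto simp: X_def lessThan_def)
  qed measurable
  then show ?thesis using integral_split_nat_sums[OF int X] by simp
qed

text \<open>
  Conditioning on the atoms replaces each mark by its probability: the product is affine in every
  mark, and the marks of distinct atoms are conditionally independent.
\<close>

lemma integral_marked_prod:
  assumes h[measurable]: "h \<in> borel_measurable M"
    and h01: "\<And>q. q \<in> space M \<Longrightarrow> 0 \<le> h q" "\<And>q. q \<in> space M \<Longrightarrow> h q \<le> (1::real)"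
  shows "(\<integral>\<omega>. (\<Prod>i | enat i < N \<omega>. 1 - of_bool (R i \<omega>) * h (Q i \<omega>)) \<partial>P) =
    (\<integral>\<omega>. (\<Prod>i | enat i < N \<omega>. 1 - t (Q i \<omega>) * h (Q i \<omega>)) \<partial>P)"
proof -
  have th: "0 \<le> t q * h q \<and> t q * h q \<le> 1" if "q \<in> space M" for q
    using h01 t01 that by (auto intro: mult_le_one)
  have "(\<integral>\<omega>. of_bool (N \<omega> = enat r) * (\<Prod>i<r. 1 - of_bool (R i \<omega>) * h (Q i \<omega>)) \<partial>P) =
      (\<integral>\<omega>. of_bool (N \<omega> = enat r) * (\<Prod>i<r. 1 - t (Q i \<omega>) * h (Q i \<omega>)) \<partial>P)" for r
  proof -
    have int1: "integrable P (\<lambda>\<omega>. of_bool (N \<omega> = enat r) * ((\<Prod>i\<in>S. - h (Q i \<omega>)) * of_bool (\<forall>i\<in>S. R i \<omega>)))"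
      if "S \<in> Pow {..<r}" for S
    proof (rule integrable_const_bound[where B = 1])
      have "finite S" using that finite_subset by auto
      then show "(\<lambda>\<omega>. of_bool (N \<omega> = enat r) * ((\<Prod>i\<in>S. - h (Q i \<omega>)) * of_bool (\<forall>i\<in>S. R i \<omega>))) \<in> borel_measurable P"
        by measurable
      show "AE \<omega> in P. norm (of_bool (N \<omega> = enat r) * ((\<Prod>i\<in>S. - h (Q i \<omega>)) * of_bool (\<forall>i\<in>S. R i \<omega>))) \<le> 1"
        unfolding real_norm_def abs_mult abs_prod
        using h01 Q_space by (intro AE_I2 mult_le_one prod_le_1 prod_nonneg mult_nonneg_nonneg) auto
    qed
    have int2: "integrable P (\<lambda>\<omega>. of_bool (N \<omega> = enat r) * (\<Prod>i\<in>S. - (t (Q i \<omega>) * h (Q i \<omega>))))"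
      if "S \<in> Pow {..<r}" for S
    proof (rule integrable_const_bound[where B = 1])
      show "AE \<omega> in P. norm (of_bool (N \<omega> = enat r) * (\<Prod>i\<in>S. - (t (Q i \<omega>) * h (Q i \<omega>)))) \<le> 1"
        unfolding real_norm_def abs_mult[of "of_bool _"] abs_prod
        using th Q_space by (intro AE_I2 mult_le_one prod_le_1 prod_nonneg) auto
    qed measurable
    have "(\<integral>\<omega>. of_bool (N \<omega> = enat r) * (\<Prod>i<r. 1 - of_bool (R i \<omega>) * h (Q i \<omega>)) \<partial>P) =
       (\<Sum>S\<in>Pow {..<r}. \<integral>\<omega>. of_bool (N \<omega> = enat r) * ((\<Prod>i\<in>S. - h (Q i \<omega>)) * of_bool (\<forall>i\<in>S. R i \<omega>)) \<partial>P)"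
      unfolding prod_one_minus_expand[OF finite_lessThan] sum_distrib_left
      using int1 by (rule Bochner_Integration.integral_sum)
    also have "\<dots> = (\<Sum>S\<in>Pow {..<r}. \<integral>\<omega>. of_bool (N \<omega> = enat r) * (\<Prod>i\<in>S. - (t (Q i \<omega>) * h (Q i \<omega>))) \<partial>P)"
      by (intro sum.cong refl integral_marked_subset h h01) auto
    also have "\<dots> = (\<integral>\<omega>. (\<Sum>S\<in>Pow {..<r}. of_bool (N \<omega> = enat r) * (\<Prod>i\<in>S. - (t (Q i \<omega>) * h (Q i \<omega>)))) \<partial>P)"
      using int2 by (rule Bochner_Integration.integral_sum[symmetric])
    also have "\<dots> = (\<integral>\<omega>. of_bool (N \<omega> = enat r) * (\<Prod>i<r. 1 - t (Q i \<omega>) * h (Q i \<omega>)) \<partial>P)"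
      using prod_one_minus_expand[OF finite_lessThan, of "\<lambda>_. True"]
      by (simp add: sum_distrib_left)
    finally show ?thesis .
  qed
  moreover have "(\<lambda>r. \<integral>\<omega>. of_bool (N \<omega> = enat r) * (\<Prod>i<r. 1 - of_bool (R i \<omega>) * h (Q i \<omega>)) \<partial>P) sums
      (\<integral>\<omega>. (\<Prod>i | enat i < N \<omega>. 1 - of_bool (R i \<omega>) * h (Q i \<omega>)) \<partial>P)"
    using h01 Q_space by (intro integral_atom_prod_sums) auto
  moreover have "(\<lambda>r. \<integral>\<omega>. of_bool (N \<omega> = enat r) * (\<Prod>i<r. 1 - t (Q i \<omega>) * h (Q i \<omega>)) \<partial>P) sums
      (\<integral>\<omega>. (\<Prod>i | enat i < N \<omega>. 1 - t (Q i \<omega>) * h (Q i \<omega>)) \<partial>P)"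
    using th Q_space by (intro integral_atom_prod_sums) auto
  ultimately show ?thesis by (simp add: sums_iff)
qed

text \<open>
  The generating function of the retained counts is the functional of the whole process at
  \<open>1 - t * h\<close>, with \<open>h\<close> as below. Its exponent is linear in \<open>h\<close> and therefore splits over the regions.
\<close>

theorem retained_poisson:
  assumes \<eta>: "\<And>\<omega>. \<omega> \<in> space P \<Longrightarrow> \<eta> \<omega> = sum_dirac M {i. enat i < N \<omega> \<and> R i \<omega>} (\<lambda>i. Q i \<omega>)"
  shows "poisson_point_process P (density \<Lambda> (\<lambda>q. ennreal (t q))) \<eta>"
proof (rule poisson_point_processI_pgf)
  let ?D = "density \<Lambda> (\<lambda>q. ennreal (t q))"
  have sp: "space \<Lambda> = space M" using sets_\<Lambda> by (rule sets_eq_imp_space_eq)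
  have setsD: "sets ?D = sets M" using sets_\<Lambda> by simp
  have [measurable_cong]: "sets \<Lambda> = sets M" by (rule sets_\<Lambda>)
  have int: "integrable \<Lambda> (\<lambda>q. t q * indicator A q)" if [measurable]: "A \<in> sets M" for A
  proof (rule \<Lambda>.integrable_const_bound[where B = 1])
    show "AE q in \<Lambda>. norm (t q * indicator A q) \<le> 1"
      using t01 sp by (intro AE_I2) (auto simp: indicator_def)
  qed measurable
  have emD: "emeasure ?D A = ennreal (\<integral>q. t q * indicator A q \<partial>\<Lambda>)" if [measurable]: "A \<in> sets M" for A
  proof -
    have "emeasure ?D A = (\<integral>\<^sup>+q. ennreal (t q) * indicator A q \<partial>\<Lambda>)"
      by (rule emeasure_density) measurable
    also have "\<dots> = (\<integral>\<^sup>+q. ennreal (t q * indicator A q) \<partial>\<Lambda>)"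
      by (intro nn_integral_cong) (auto simp: indicator_def)
    also have "\<dots> = ennreal (\<integral>q. t q * indicator A q \<partial>\<Lambda>)"
      using t01 sp by (intro nn_integral_eq_integral int) (auto simp: indicator_def)
    finally show ?thesis .
  qed
  have mD: "measure ?D A = (\<integral>q. t q * indicator A q \<partial>\<Lambda>)" if A: "A \<in> sets M" for A
    unfolding measure_def emD[OF A] using t01 sp
    by (intro enn2real_ennreal integral_nonneg_AE) (auto simp: indicator_def)
  show "prob_space P" by (rule prob_space_axioms)
  show "finite_measure ?D"
    using emD[OF sets.top] sp by (intro finite_measureI) simp
  show "point_process P ?D \<eta>"
    by (rule point_process_retained[OF R setsD \<eta>])
  have em: "emeasure (\<eta> \<omega>) A = emeasure (count_space UNIV) {i. (enat i < N \<omega> \<and> R i \<omega>) \<and> Q i \<omega> \<in> A}"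
    if "A \<in> sets M" "\<omega> \<in> space P" for A \<omega>
    using that by (simp add: \<eta> emeasure_sum_dirac Q_space)
  show "AE \<omega> in P. emeasure (\<eta> \<omega>) A < \<infinity>" if "A \<in> sets ?D" for A
    using AE_finitely_many_atoms AE_space
  proof eventually_elim
    case (elim \<omega>)
    have "finite {i. (enat i < N \<omega> \<and> R i \<omega>) \<and> Q i \<omega> \<in> A}"
      by (rule finite_subset[OF _ finite_atoms[OF elim(1)]]) auto
    then show ?case using elim that setsD by (simp add: em less_top[symmetric])
  qed
  fix m :: nat and A :: "nat \<Rightarrow> 'x set" and s :: "nat \<Rightarrow> real"
  assume "\<And>k. k < m \<Longrightarrow> A k \<in> sets ?D" and disj: "disjoint_family_on A {..<m}"
    and s: "\<And>k. 0 \<le> s k \<and> s k \<le> 1"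
  then have A[measurable]: "A k \<in> sets M" if "k < m" for k using that setsD by simp
  define h where "h q = (\<Sum>k<m. (1 - s k) * indicator (A k) q)" for q
  have h[measurable]: "h \<in> borel_measurable M" unfolding h_def by measurable
  have h01: "0 \<le> h q" "h q \<le> 1" for q
  proof -
    show "0 \<le> h q" unfolding h_def using s by (intro sum_nonneg) auto
    \<comment> \<open>The grouping identity with a single atom at \<open>q\<close> writes \<open>1 - h q\<close> as a product of nonnegative factors.\<close>
    have "1 - h q = (\<Prod>k<m. (1 - (1 - s k)) ^ card {i\<in>{()}. q \<in> A k})"
      unfolding h_def using prod_disjoint_marks[OF _ _ disj, of "{()}" "\<lambda>k. 1 - s k" "\<lambda>_. q"] by simp
    also have "\<dots> \<ge> 0" using s by (intro prod_nonneg) auto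
    finally show "h q \<le> 1" by simp
  qed
  have [measurable]: "(\<lambda>\<omega>. emeasure (\<eta> \<omega>) (A k)) \<in> borel_measurable P" if "k < m" for k
    using measurable_emeasure_process[OF point_process_retained[OF R setsD \<eta>]] A[OF that] setsD by simp
  have "(\<integral>\<omega>. (\<Prod>k<m. s k ^ nat_count (emeasure (\<eta> \<omega>) (A k))) \<partial>P) =
      (\<integral>\<omega>. (\<Prod>i | enat i < N \<omega>. 1 - of_bool (R i \<omega>) * h (Q i \<omega>)) \<partial>P)"
  proof (rule integral_cong_AE)
    show "(\<lambda>\<omega>. \<Prod>i | enat i < N \<omega>. 1 - of_bool (R i \<omega>) * h (Q i \<omega>)) \<in> borel_measurable P"
      by (rule measurable_atom_prod) measurable
    show "AE \<omega> in P. (\<Prod>k<m. s k ^ nat_count (emeasure (\<eta> \<omega>) (A k))) =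
        (\<Prod>i | enat i < N \<omega>. 1 - of_bool (R i \<omega>) * h (Q i \<omega>))"
      using AE_finitely_many_atoms AE_space
    proof eventually_elim
      case (elim \<omega>)
      let ?I = "{i\<in>{i. enat i < N \<omega>}. R i \<omega>}"
      have fin: "finite {i. enat i < N \<omega>}" by (rule finite_atoms[OF elim(1)])
      have "(\<Prod>i | enat i < N \<omega>. 1 - of_bool (R i \<omega>) * h (Q i \<omega>)) =
          (\<Prod>i\<in>{i. enat i < N \<omega>}. if R i \<omega> then 1 - h (Q i \<omega>) else 1)"
        by (intro prod.cong) auto
      also have "\<dots> = (\<Prod>i\<in>?I. 1 - h (Q i \<omega>))"
        by (rule prod.inter_filter[OF fin, symmetric])
      also have "\<dots> = (\<Prod>k<m. (1 - (1 - s k)) ^ card {i\<in>?I. Q i \<omega> \<in> A k})"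
        unfolding h_def using fin by (intro prod_disjoint_marks disj) auto
      also have "\<dots> = (\<Prod>k<m. s k ^ nat_count (emeasure (\<eta> \<omega>) (A k)))"
        using elim(2) by (intro prod.cong refl) (simp add: em)
      finally show ?case by simp
    qed
  qed measurable
  also have "\<dots> = (\<integral>\<omega>. (\<Prod>i | enat i < N \<omega>. 1 - t (Q i \<omega>) * h (Q i \<omega>)) \<partial>P)"
    by (intro integral_marked_prod h h01)
  also have "\<dots> = exp (- (\<integral>q. t q * h q \<partial>\<Lambda>))"
    using t01 h01 by (intro poisson_functional) (auto intro: mult_le_one)
  also have "(\<integral>q. t q * h q \<partial>\<Lambda>) = (\<integral>q. (\<Sum>k<m. (1 - s k) * (t q * indicator (A k) q)) \<partial>\<Lambda>)"
    unfolding h_def sum_distrib_left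
    by (intro Bochner_Integration.integral_cong sum.cong refl mult.left_commute)
  also have "\<dots> = (\<Sum>k<m. (1 - s k) * measure ?D (A k))"
    using int[OF A] mD[OF A] by (subst Bochner_Integration.integral_sum) auto
  also have "exp (- (\<Sum>k<m. (1 - s k) * measure ?D (A k))) = (\<Prod>k<m. exp (- (1 - s k) * measure ?D (A k)))"
    by (simp only: sum_negf[symmetric] mult_minus_left[symmetric] exp_sum finite_lessThan)
  finally show "(\<integral>\<omega>. (\<Prod>k<m. s k ^ nat_count (emeasure (\<eta> \<omega>) (A k))) \<partial>P) =
    (\<Prod>k<m. exp (- (1 - s k) * measure ?D (A k)))" .
qed

end

section \<open>The likelihood-thinned process\<close>

lemma all_component_coins_succeed:
  assumes "\<And>j. j \<in> {1..J} \<Longrightarrow> 0 < a j" "\<And>j. j \<in> {1..J} \<Longrightarrow> p j q \<in> {0..1}"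
    and "\<And>j. j \<in> {1..J} \<Longrightarrow> 2 \<le> n j"
  shows "(\<Prod>j=1..J. pmf (run_prog (p j q) (likelihood_coin (a j) (n j) (y j))) True) =
    exp (- total_shift J a n y) * reduced_likelihood J a p y q"
proof -
  have "(\<Prod>j=1..J. pmf (run_prog (p j q) (likelihood_coin (a j) (n j) (y j))) True) =
      (\<Prod>j=1..J. exp (- a j * ((p j q - y j)^2 + bern_b (n j) (y j))))"
    using assms by (intro prod.cong refl pmf_likelihood_coin) auto
  also have "\<dots> = exp (\<Sum>j=1..J. - (a j * bern_b (n j) (y j)) + - (a j * (p j q - y j)^2))"
    by (simp add: exp_sum algebra_simps)
  also have "\<dots> = exp (- total_shift J a n y + - (\<Sum>j=1..J. a j * (p j q - y j)^2))"
    by (simp only: sum.distrib sum_negf total_shift_def)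
  finally show ?thesis by (simp only: reduced_likelihood_def mult_exp_exp)
qed

theorem corollary3p4:
  fixes \<mu>\<^sub>0 :: "'x measure" and P :: "'w measure"
    and J :: nat and \<sigma> y a :: "nat \<Rightarrow> real" and n :: "nat \<Rightarrow> nat"
    and p :: "nat \<Rightarrow> 'x \<Rightarrow> real" and \<gamma> :: real
    and N :: "'w \<Rightarrow> enat" and Q :: "nat \<Rightarrow> 'w \<Rightarrow> 'x"
    and G :: "nat \<Rightarrow> nat \<Rightarrow> 'w \<Rightarrow> bool"
    and \<Xi> \<eta> :: "'w \<Rightarrow> 'x measure"
  assumes "prob_space \<mu>\<^sub>0"
    and "\<And>j. j \<in> {1..J} \<Longrightarrow> (\<sigma> j)^2 > 0"
    and "\<And>j. j \<in> {1..J} \<Longrightarrow> a j = 1 / (2 * (\<sigma> j)^2)"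
    and "\<And>j. j \<in> {1..J} \<Longrightarrow> y j \<in> {0..1}"
    and "\<And>j q. j \<in> {1..J} \<Longrightarrow> q \<in> space \<mu>\<^sub>0 \<Longrightarrow> p j q \<in> {0..1}"
    and "reduced_likelihood J a p y \<in> borel_measurable \<mu>\<^sub>0"
    and "\<And>j. j \<in> {1..J} \<Longrightarrow> n j \<ge> 2"
    and "\<gamma> > 0"
    and "prob_space P"
    and "N \<in> measurable P (count_space UNIV)"
    and "\<And>i. Q i \<in> measurable P \<mu>\<^sub>0"
    and "\<And>\<omega>. \<omega> \<in> space P \<Longrightarrow>
           \<Xi> \<omega> = sum_dirac \<mu>\<^sub>0 {i. enat i < N \<omega>} (\<lambda>i. Q i \<omega>)"
    and "poisson_point_process P
           (scale_measure (ennreal (\<gamma> * exp (total_shift J a n y))) \<mu>\<^sub>0) \<Xi>"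
    and "component_coins P \<mu>\<^sub>0 N Q J a n y p G"
    and "\<And>\<omega>. \<omega> \<in> space P \<Longrightarrow>
           \<eta> \<omega> = sum_dirac \<mu>\<^sub>0 {i. enat i < N \<omega> \<and> (\<forall>j\<in>{1..J}. G i j \<omega>)} (\<lambda>i. Q i \<omega>)"
  shows "poisson_point_process P
           (scale_measure (ennreal \<gamma>)
              (density \<mu>\<^sub>0 (\<lambda>q. ennreal (reduced_likelihood J a p y q)))) \<eta>"
proof -
  interpret \<mu>: prob_space \<mu>\<^sub>0 by fact
  let ?B = "total_shift J a n y" and ?L = "reduced_likelihood J a p y"
  let ?\<Lambda> = "scale_measure (ennreal (\<gamma> * exp ?B)) \<mu>\<^sub>0"
  \<comment> \<open>Only the product over the components is known to be measurable, through the likelihood.\<close>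
  define t where "t q = exp (- ?B) * ?L q" for q
  have apos: "0 < a j" if "j \<in> {1..J}" for j using assms(2,3)[OF that] by simp
  have t_prod: "t q = (\<Prod>j=1..J. pmf (run_prog (p j q) (likelihood_coin (a j) (n j) (y j))) True)"
    if "q \<in> space \<mu>\<^sub>0" for q
    unfolding t_def using apos assms(5,7) that by (intro all_component_coins_succeed[symmetric]) auto
  note L[measurable] = assms(6)
  have G: "G i j \<in> measurable P (count_space UNIV)" if "j \<in> {1..J}" for i j
    using assms(14) that unfolding component_coins_def by blast
  interpret atoms: labelled_atoms P \<mu>\<^sub>0 N Q
    using assms(9-11) by (simp add: labelled_atoms_def labelled_atoms_axioms_def)
  interpret poisson_thinning P \<mu>\<^sub>0 N Q ?\<Lambda> \<Xi> "\<lambda>i \<omega>. \<forall>j\<in>{1..J}. G i j \<omega>" t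
  proof unfold_locales
    show "poisson_point_process P ?\<Lambda> \<Xi>" by fact
    show "sets ?\<Lambda> = sets \<mu>\<^sub>0" by simp
    show "emeasure ?\<Lambda> (space ?\<Lambda>) \<noteq> \<infinity>"
      by (simp add: \<mu>.emeasure_space_1 space_scale_measure)
    show "\<Xi> \<omega> = sum_dirac \<mu>\<^sub>0 {i. enat i < N \<omega>} (\<lambda>i. Q i \<omega>)" if "\<omega> \<in> space P" for \<omega>
      using assms(12) that .
    show "(\<lambda>\<omega>. \<forall>j\<in>{1..J}. G i j \<omega>) \<in> measurable P (count_space UNIV)" for i
      by (intro pred_intros_finite) (auto intro: G)
    show "t \<in> borel_measurable \<mu>\<^sub>0" unfolding t_def by measurable
    show "0 \<le> t q" if "q \<in> space \<mu>\<^sub>0" for q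
      unfolding t_prod[OF that] by (intro prod_nonneg) auto
    show "t q \<le> 1" if "q \<in> space \<mu>\<^sub>0" for q
      unfolding t_prod[OF that] by (intro prod_le_1) (auto simp: pmf_le_1)
    fix I :: "nat set" assume "finite I"
    with assms(14) have "AE \<omega> in P. (\<forall>i\<in>I. enat i < N \<omega>) \<longrightarrow>
        real_cond_exp P (atom_algebra P \<mu>\<^sub>0 N Q)
          (\<lambda>\<omega>'. of_bool (\<forall>i\<in>I. \<forall>j\<in>{1..J}. G i j \<omega>' = True)) \<omega>
        = (\<Prod>i\<in>I. \<Prod>j=1..J. pmf (run_prog (p j (Q i \<omega>)) (likelihood_coin (a j) (n j) (y j))) True)"
      unfolding component_coins_def by (elim conjE allE[of _ I] allE[of _ "\<lambda>_ _. True"]) simp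
    then show "AE \<omega> in P. (\<forall>i\<in>I. enat i < N \<omega>) \<longrightarrow>
        real_cond_exp P (atom_algebra P \<mu>\<^sub>0 N Q)
          (\<lambda>\<omega>'. of_bool (\<forall>i\<in>I. \<forall>j\<in>{1..J}. G i j \<omega>')) \<omega> = (\<Prod>i\<in>I. t (Q i \<omega>))"
      using AE_space by eventually_elim (simp add: t_prod atoms.Q_space)
  qed
  \<comment> \<open>The factor \<open>exp (- ?B)\<close> in the retention probability cancels the \<open>exp ?B\<close> in the proposal intensity.\<close>
  have "scale_measure (ennreal \<gamma>) (density \<mu>\<^sub>0 (\<lambda>q. ennreal (?L q))) =
      density ?\<Lambda> (\<lambda>q. ennreal (t q))"
  proof (rule measure_eqI)
    fix A assume "A \<in> sets (scale_measure (ennreal \<gamma>) (density \<mu>\<^sub>0 (\<lambda>q. ennreal (?L q))))"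
    then have [measurable]: "A \<in> sets \<mu>\<^sub>0" by simp
    have "emeasure (density ?\<Lambda> (\<lambda>q. ennreal (t q))) A =
        (\<integral>\<^sup>+q. ennreal (exp (- ?B)) * (ennreal (?L q) * indicator A q) \<partial>?\<Lambda>)"
    proof (subst emeasure_density)
      show "(\<lambda>q. ennreal (t q)) \<in> borel_measurable ?\<Lambda>" by measurable
      have "0 \<le> ?L q" for q by (simp add: reduced_likelihood_def)
      then show "(\<integral>\<^sup>+q. ennreal (t q) * indicator A q \<partial>?\<Lambda>) =
          (\<integral>\<^sup>+q. ennreal (exp (- ?B)) * (ennreal (?L q) * indicator A q) \<partial>?\<Lambda>)"
        by (simp add: t_def ennreal_mult mult.assoc)
    qed simp
    also have "\<dots> = ennreal (\<gamma> * exp ?B) * (ennreal (exp (- ?B)) * (\<integral>\<^sup>+q. ennreal (?L q) * indicator A q \<partial>\<mu>\<^sub>0))"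
      by (subst nn_integral_cmult) (simp_all add: nn_integral_scale_measure mult.left_commute)
    also have "\<dots> = ennreal \<gamma> * (\<integral>\<^sup>+q. ennreal (?L q) * indicator A q \<partial>\<mu>\<^sub>0)"
    proof -
      have "\<gamma> * exp ?B * exp (- ?B) = \<gamma>" by (simp add: exp_minus)
      then have "ennreal (\<gamma> * exp ?B) * ennreal (exp (- ?B)) = ennreal \<gamma>"
        using assms(8) by (simp add: ennreal_mult[symmetric])
      then show ?thesis by (simp add: mult.assoc[symmetric])
    qed
    finally show "emeasure (scale_measure (ennreal \<gamma>) (density \<mu>\<^sub>0 (\<lambda>q. ennreal (?L q)))) A =
        emeasure (density ?\<Lambda> (\<lambda>q. ennreal (t q))) A"
      by (simp add: emeasure_density)
  qed simp
  with retained_poisson[OF assms(15)] show ?thesis by simp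
qed

end
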